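(* For each $n\ge 2$ let $\boldsymbol{\theta}^*=\boldsymbol{\theta}^*_n=(\alpha_1^*,\ldots,\alpha_n^*,\beta_1^*,\ldots,\beta_{n-1}^* )^\top\in\mathbb{R}^{2n-1}$ with $\beta_n^*=0$, and let $\epsilon_n>0$ be privacy parameters that are bounded above by a fixed constant. Assume that $A\sim\mathbb{P}_{\boldsymbol{\theta}^*}$, the $p_0$ model with parameter $\boldsymbol{\theta}^*$, and let $\widehat{\boldsymbol{\theta}}_{in}$ be the estimator obtained from the moment equations based on the bi-degree sequence of the edge-flipped graph $A'$ with privacy parameter $\epsilon_n$ (all defined in the context). If $$\epsilon_n^{-1}e^{12\|\boldsymbol{\theta}^*\|_\infty}=o\big((n/\log n)^{1/2}\big),$$ then with probability approaching one as $n\to\infty$, the estimator $\widehat{\boldsymbol{\theta}}_{in}$ exists and satisfies $$\|\widehat{\boldsymbol{\theta}}_{in}-\boldsymbol{\theta}^*\|_\infty=O_p\left(\frac{(\log n)^{1/2}e^{6\|\boldsymbol{\theta}^*\|_\infty}}{n^{1/2}\epsilon_n}\right)=o_p(1).$$ Furthermore, if $\widehat{\boldsymbol{\theta}}_{in}$ exists, it is unique.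
   Context: **The $p_0$ model.** $A=(a_{i,j})_{1\le i,j\le n}$ is the adjacency matrix of a simple directed graph on nodes $1,\ldots,n$ (no self-loops: $a_{i,i}=0$). Under $\mathbb{P}_{\boldsymbol{\theta}}$ with $\boldsymbol{\theta}=(\alpha_1,\ldots,\alpha_n,\beta_1,\ldots,\beta_{n-1})^\top$ and the identification convention $\beta_n=0$, the entries $a_{i,j}$, $1\le i\ne j\le n$, are mutually independent Bernoulli random variables with $$\mathbb{P}(a_{i,j}=1)=\frac{e^{\alpha_i+\beta_j}}{1+e^{\alpha_i+\beta_j}}.$$ Equivalently, the graph has probability proportional to $\exp(\sum_i\alpha_i d_i^+ +\sum_j\beta_j d_j^-)$, where $d_i^+=\sum_{j\ne i}a_{i,j}$ and $d_j^-=\sum_{i\ne j}a_{i,j}$. **Edge-flipping mechanism.** Given $\epsilon_n>0$, set $p=p_n=1/(1+e^{-\epsilon_n})$. Independently over all ordered pairs $(i,j)$, $i\neq j$ (and independently of $A$), set $a'_{i,j}=a_{i,j}$ with probability $p$ and $a'_{i,j}=1-a_{i,j}$ with probability $1-p$. The flipped bi-degrees are $d_i'^{+}=\sum_{j\ne i}a'_{i,j}$ and $d_j'^{-}=\sum_{i\ne j}a'_{i,j}$. **Estimator.** $\widehat{\boldsymbol{\theta}}_{in}=(\hat\alpha_1,\ldots,\hat\alpha_n,\hat\beta_1,\ldots,\hat\beta_{n-1})^\top\in\mathbb{R}^{2n-1}$ (with $\hat\beta_n=0$) denotes a solution $\boldsymbol{\theta}$ of the system of $2n-1$ equations $$d_i'^{+}=\sum_{j\ne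 i}\frac{p e^{\alpha_i+\beta_j}+(1-p)}{1+e^{\alpha_i+\beta_j}},\quad i=1,\ldots,n,$$ $$d_j'^{-}=\sum_{i\ne j}\frac{p e^{\alpha_i+\beta_j}+(1-p)}{1+e^{\alpha_i+\beta_j}},\quad j=1,\ldots,n-1,$$ with $\beta_n=0$. "Exists" means that this system has a solution. **Norm.** $\|\cdot\|_\infty$ is the maximum absolute entry of a vector. *)

theory Defs
  imports "HOL-Probability.Probability" "HOL-Library.Landau_Symbols"
begin

type_synonym digraph = "nat \<times> nat \<Rightarrow> bool"

definition ordered_pairs :: "nat \<Rightarrow> (nat \<times> nat) set" where
  "ordered_pairs n = {(i, j). i \<in> {1..n} \<and> j \<in> {1..n} \<and> i \<noteq> j}"

definition out_degree :: "nat \<Rightarrow> digraph \<Rightarrow> nat \<Rightarrow> nat" where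
  "out_degree n G i = (\<Sum>j\<in>{1..n} - {i}. of_bool (G (i, j)))"

definition in_degree :: "nat \<Rightarrow> digraph \<Rightarrow> nat \<Rightarrow> nat" where
  "in_degree n G j = (\<Sum>i\<in>{1..n} - {j}. of_bool (G (i, j)))"

text \<open>
  The dimension varies with the number of nodes, so a vector in m-dimensional real space is
  a function on \<open>{1..m}\<close> that is \<open>undefined\<close> elsewhere; equality of such functions is
  equality of vectors.
\<close>

definition rvec :: "nat \<Rightarrow> (nat \<Rightarrow> real) set" where
  "rvec m = {1..m} \<rightarrow>\<^sub>E UNIV"

definition max_norm :: "nat \<Rightarrow> (nat \<Rightarrow> real) \<Rightarrow> real" where
  "max_norm m x = Max ((\<lambda>k. \<bar>x k\<bar>) ` {1..m})"

text \<open>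
  A parameter \<open>\<theta> \<in> rvec (2 * n - 1)\<close> lists \<open>\<alpha>\<close> at positions \<open>1, \<dots>, n\<close> and then
  \<open>\<beta>\<close> (indices \<open>1, \<dots>, n - 1\<close>) at positions \<open>n + 1, \<dots>, 2 * n - 1\<close>; the last \<open>\<beta>\<close> is \<open>0\<close>.
\<close>

definition alpha :: "(nat \<Rightarrow> real) \<Rightarrow> nat \<Rightarrow> real" where
  "alpha \<theta> i = \<theta> i"

definition beta :: "nat \<Rightarrow> (nat \<Rightarrow> real) \<Rightarrow> nat \<Rightarrow> real" where
  "beta n \<theta> j = (if j = n then 0 else \<theta> (n + j))"

definition p0_model :: "nat \<Rightarrow> (nat \<Rightarrow> real) \<Rightarrow> digraph pmf" where
  "p0_model n \<theta> = Pi_pmf (ordered_pairs n) False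
     (\<lambda>(i, j). bernoulli_pmf (exp (alpha \<theta> i + beta n \<theta> j) / (1 + exp (alpha \<theta> i + beta n \<theta> j))))"

definition keep_prob :: "real \<Rightarrow> real" where
  "keep_prob \<epsilon> = 1 / (1 + exp (- \<epsilon>))"

text \<open>
  \<open>K e\<close> says that entry \<open>e\<close> is kept rather than flipped. The default values are chosen so that
  the flipped graph, like the original one, has no edges outside \<open>ordered_pairs n\<close>.
\<close>

definition keep_indicators :: "nat \<Rightarrow> real \<Rightarrow> (nat \<times> nat \<Rightarrow> bool) pmf" where
  "keep_indicators n \<epsilon> = Pi_pmf (ordered_pairs n) True (\<lambda>_. bernoulli_pmf (keep_prob \<epsilon>))"

definition flipped_model :: "nat \<Rightarrow> real \<Rightarrow> (nat \<Rightarrow> real) \<Rightarrow> digraph pmf" where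
  "flipped_model n \<epsilon> \<theta> =
     map_pmf (\<lambda>(A, K) e. if K e then A e else \<not> A e)
       (pair_pmf (p0_model n \<theta>) (keep_indicators n \<epsilon>))"

definition flipped_mean :: "nat \<Rightarrow> real \<Rightarrow> (nat \<Rightarrow> real) \<Rightarrow> nat \<Rightarrow> nat \<Rightarrow> real" where
  "flipped_mean n \<epsilon> \<theta> i j =
     (keep_prob \<epsilon> * exp (alpha \<theta> i + beta n \<theta> j) + (1 - keep_prob \<epsilon>))
       / (1 + exp (alpha \<theta> i + beta n \<theta> j))"

definition is_estimate :: "nat \<Rightarrow> real \<Rightarrow> digraph \<Rightarrow> (nat \<Rightarrow> real) \<Rightarrow> bool" where
  "is_estimate n \<epsilon> G \<theta> \<longleftrightarrow> \<theta> \<in> rvec (2 * n - 1) \<and>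
     (\<forall>i\<in>{1..n}. real (out_degree n G i) = (\<Sum>j\<in>{1..n} - {i}. flipped_mean n \<epsilon> \<theta> i j)) \<and>
     (\<forall>j\<in>{1..n - 1}. real (in_degree n G j) = (\<Sum>i\<in>{1..n} - {j}. flipped_mean n \<epsilon> \<theta> i j))"

text \<open>Stochastic order symbols; the probability space may change with \<open>n\<close>.\<close>

definition bigo_prob ::
    "(nat \<Rightarrow> 'a measure) \<Rightarrow> (nat \<Rightarrow> 'a \<Rightarrow> real) \<Rightarrow> (nat \<Rightarrow> real) \<Rightarrow> bool" where
  "bigo_prob M X r \<longleftrightarrow>
     (\<forall>\<delta>>0. \<exists>K>0. \<forall>\<^sub>F n in sequentially. \<P>(\<omega> in M n. \<bar>X n \<omega>\<bar> > K * \<bar>r n\<bar>) < \<delta>)"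

definition smallo_prob ::
    "(nat \<Rightarrow> 'a measure) \<Rightarrow> (nat \<Rightarrow> 'a \<Rightarrow> real) \<Rightarrow> (nat \<Rightarrow> real) \<Rightarrow> bool" where
  "smallo_prob M X r \<longleftrightarrow>
     (\<forall>c>0. (\<lambda>n. \<P>(\<omega> in M n. \<bar>X n \<omega>\<bar> > c * \<bar>r n\<bar>)) \<longlonglongrightarrow> 0)"

end

theory Submission
  imports Defs
begin

text \<open>
  Write \<open>p\<close> for the probability of keeping an entry and \<open>x\<^sub>i\<^sub>j = \<alpha>\<^sub>i + \<beta>\<^sub>j\<close>. The mean of a flipped entry is
  \<open>(1 - p) + (2 p - 1) \<sigma>(x\<^sub>i\<^sub>j)\<close> with \<open>\<sigma>\<close> the logistic function, so the debiased entry
  \<open>y\<^sub>i\<^sub>j = (a'\<^sub>i\<^sub>j - (1 - p)) / (2 p - 1)\<close> is unbiased for \<open>\<sigma>(x\<^sub>i\<^sub>j)\<close>, and the estimating equations ask that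
  \<open>\<sigma>(x\<^sub>i\<^sub>j)\<close> and \<open>y\<^sub>i\<^sub>j\<close> have equal row sums and equal column sums off the diagonal. The column of the
  last node follows from the others because both sides have the same total.

  Stability. For two parameters, \<open>\<sigma>(x\<^sub>i\<^sub>j) - \<sigma>(x'\<^sub>i\<^sub>j) = w\<^sub>i\<^sub>j (x\<^sub>i\<^sub>j - x'\<^sub>i\<^sub>j)\<close> holds exactly, with a weight \<open>w\<^sub>i\<^sub>j\<close>
  between \<open>m\<close> and \<open>1/4\<close>. With the sign of \<open>\<beta>\<close> reversed, row and column sums of such an expression
  are a weighted graph Laplacian of the complete bipartite graph minus a perfect matching. Its
  unweighted spectral gap is at least \<open>n - 2\<close>, so row and column sums bounded by \<open>r\<close> force the
  \<open>\<ell>\<^sup>1\<close> norm of the (suitably shifted) difference to be at most \<open>6 r / m\<close>. Solving the equation of a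
  single node for its own unknown turns this into a bound of order \<open>r / (m\<^sup>2 n)\<close> on every
  coordinate (\<open>weighted_system_bound\<close>). The shift is undone by comparing with \<open>\<beta>\<^sub>n = 0\<close>.

  Existence. Let \<open>B\<close> be the maximum norm of the true parameter. Outside \<open>[-L, L]\<close>, \<open>L = 2 B + 2\<close>,
  replace \<open>\<sigma>\<close> by its continuation with slope \<open>m = e\<^bsup>-L\<^esup> / 4\<close>. The modified equations are the
  critical point equations of a convex function that is coercive on \<open>\<beta>\<^sub>n = 0\<close>, hence solvable
  (\<open>moment_equations_solvable\<close>). The stability bound holds for them globally, so once
  \<open>r / (m\<^sup>2 n)\<close> is small the solution lies within distance \<open>1\<close> of the truth, where all arguments are
  in \<open>[-L, L]\<close> and the modification is invisible (\<open>logistic_moment_solution_near\<close>).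
  Uniqueness is the stability bound with \<open>r = 0\<close>; it needs \<open>n \<ge> 3\<close>, and for \<open>n = 2\<close> no estimate exists.

  Probability. The flipped entries are independent Bernoulli variables, so by Hoeffding's inequality
  and a union bound all \<open>2 n\<close> degrees deviate from their means by less than \<open>sqrt (n ln n)\<close>, except with
  probability at most \<open>4 / n\<close>. As \<open>2 p - 1\<close> is at least a constant times \<open>\<epsilon>\<close>, this gives an error of order
  \<open>e\<^bsup>4B\<^esup> sqrt (ln n / n) / \<epsilon>\<close>, which is within the asserted rate, and the growth hypothesis makes
  the rate tend to \<open>0\<close>.
\<close>

section \<open>Weighted bipartite systems without diagonal\<close>

lemma sum_offdiag:
  fixes f :: "'a \<Rightarrow> 'a \<Rightarrow> 'b::ab_group_add"
  assumes "finite S"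
  shows "(\<Sum>i\<in>S. \<Sum>j\<in>S - {i}. f i j) = (\<Sum>i\<in>S. \<Sum>j\<in>S. f i j) - (\<Sum>i\<in>S. f i i)"
  using assms by (simp add: sum_diff1 sum_subtractf)

lemma sum_offdiag_swap:
  fixes f :: "'a \<Rightarrow> 'a \<Rightarrow> 'b::ab_group_add"
  assumes "finite S"
  shows "(\<Sum>i\<in>S. \<Sum>j\<in>S - {i}. f i j) = (\<Sum>j\<in>S. \<Sum>i\<in>S - {j}. f i j)"
  using assms by (simp add: sum_diff1 sum_subtractf) (rule sum.swap)

text \<open>
  Summation by parts: the energy of a weighted system is the pairing of the unknowns with
  the row and column sums.
\<close>
lemma offdiag_energy:
  fixes a b :: "'a \<Rightarrow> real"
  assumes "finite S"
  shows "(\<Sum>i\<in>S. \<Sum>j\<in>S - {i}. q i j * (a i + b j)) =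
    (\<Sum>i\<in>S. a i * (\<Sum>j\<in>S - {i}. q i j)) + (\<Sum>j\<in>S. b j * (\<Sum>i\<in>S - {j}. q i j))"
proof -
  have "(\<Sum>i\<in>S. \<Sum>j\<in>S - {i}. q i j * (a i + b j)) =
      (\<Sum>i\<in>S. \<Sum>j\<in>S - {i}. a i * q i j) + (\<Sum>i\<in>S. \<Sum>j\<in>S - {i}. b j * q i j)"
    by (simp add: sum.distrib algebra_simps)
  also have "(\<Sum>i\<in>S. \<Sum>j\<in>S - {i}. b j * q i j) = (\<Sum>j\<in>S. \<Sum>i\<in>S - {j}. b j * q i j)"
    by (rule sum_offdiag_swap[OF assms])
  finally show ?thesis by (simp add: sum_distrib_left)
qed

text \<open>
  Over all pairs, diagonal included, the squares add up to \<open>card S\<close> times the sum of squares of the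
  unknowns, plus \<open>2 * sum a S * sum b S\<close>, which is nonnegative for balanced unknowns. The diagonal
  takes away at most twice the sum of squares.
\<close>
lemma offdiag_spectral_gap:
  fixes a b :: "'a \<Rightarrow> real"
  assumes S: "finite S" and balanced: "sum a S = sum b S"
  shows "(real (card S) - 2) * (\<Sum>i\<in>S. (a i)\<^sup>2 + (b i)\<^sup>2) \<le> (\<Sum>i\<in>S. \<Sum>j\<in>S - {i}. (a i + b j)\<^sup>2)"
proof -
  let ?Q = "\<Sum>i\<in>S. (a i)\<^sup>2 + (b i)\<^sup>2"
  have "(\<Sum>i\<in>S. \<Sum>j\<in>S. (a i + b j)\<^sup>2) =
      (\<Sum>i\<in>S. real (card S) * (a i)\<^sup>2 + (\<Sum>j\<in>S. (b j)\<^sup>2) + 2 * a i * sum b S)"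
    by (simp add: power2_sum sum.distrib sum_distrib_left mult.assoc)
  also have "\<dots> = real (card S) * ?Q + 2 * sum a S * sum b S"
    by (simp add: sum.distrib sum_distrib_left sum_distrib_right algebra_simps)
  finally have full: "(\<Sum>i\<in>S. \<Sum>j\<in>S. (a i + b j)\<^sup>2) = real (card S) * ?Q + 2 * (sum b S)\<^sup>2"
    using balanced by (simp add: power2_eq_square)
  have "(\<Sum>i\<in>S. (a i + b i)\<^sup>2) \<le> (\<Sum>i\<in>S. 2 * ((a i)\<^sup>2 + (b i)\<^sup>2))"
  proof (rule sum_mono)
    fix i
    show "(a i + b i)\<^sup>2 \<le> 2 * ((a i)\<^sup>2 + (b i)\<^sup>2)"
      using zero_le_power2[of "a i - b i"] by (simp add: power2_eq_square algebra_simps)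
  qed
  then have "(\<Sum>i\<in>S. (a i + b i)\<^sup>2) \<le> 2 * ?Q" by (simp add: sum_distrib_left)
  moreover have "(\<Sum>i\<in>S. \<Sum>j\<in>S - {i}. (a i + b j)\<^sup>2) = real (card S) * ?Q + 2 * (sum b S)\<^sup>2 - (\<Sum>i\<in>S. (a i + b i)\<^sup>2)"
    using sum_offdiag[OF S, of "\<lambda>i j. (a i + b j)\<^sup>2"] full by simp
  ultimately show ?thesis
    using zero_le_power2[of "sum b S"] unfolding left_diff_distrib by linarith
qed

text \<open>
  The energy is at least \<open>m * (card S - 2) * Q\<close> by the spectral gap, where \<open>Q\<close> is the sum of squares,
  and at most \<open>r * T\<close>, where \<open>T\<close> is the \<open>\<ell>\<^sup>1\<close> norm. The Cauchy-Schwarz inequality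
  \<open>T\<^sup>2 \<le> 2 * card S * Q\<close> then makes \<open>T\<close> bounded independently of \<open>card S\<close>.
\<close>
lemma weighted_balanced_bound:
  fixes a b :: "'a \<Rightarrow> real" and w :: "'a \<Rightarrow> 'a \<Rightarrow> real"
  assumes S: "finite S" and card: "card S \<ge> 3" and m: "m > 0" and r: "r \<ge> 0"
    and w: "\<And>i j. i \<in> S \<Longrightarrow> j \<in> S \<Longrightarrow> i \<noteq> j \<Longrightarrow> m \<le> w i j \<and> w i j \<le> 1/4"
    and row: "\<And>i. i \<in> S \<Longrightarrow> \<bar>\<Sum>j\<in>S - {i}. w i j * (a i + b j)\<bar> \<le> r"
    and col: "\<And>j. j \<in> S \<Longrightarrow> \<bar>\<Sum>i\<in>S - {j}. w i j * (a i + b j)\<bar> \<le> r"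
    and balanced: "sum a S = sum b S"
  shows "(\<Sum>i\<in>S. \<bar>a i\<bar> + \<bar>b i\<bar>) \<le> 6 * r / m"
proof -
  define n where "n = real (card S)"
  have n: "n \<ge> 3" using card by (simp add: n_def)
  define Q where "Q = (\<Sum>i\<in>S. (a i)\<^sup>2 + (b i)\<^sup>2)"
  define T where "T = (\<Sum>i\<in>S. \<bar>a i\<bar> + \<bar>b i\<bar>)"
  have T0: "T \<ge> 0" unfolding T_def by (intro sum_nonneg) auto
  have "m * ((n - 2) * Q) \<le> m * (\<Sum>i\<in>S. \<Sum>j\<in>S - {i}. (a i + b j)\<^sup>2)"
    unfolding Q_def n_def using m by (intro mult_left_mono offdiag_spectral_gap[OF S balanced]) auto
  also have "\<dots> = (\<Sum>i\<in>S. \<Sum>j\<in>S - {i}. m * (a i + b j)\<^sup>2)"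
    by (simp add: sum_distrib_left)
  also have "\<dots> \<le> (\<Sum>i\<in>S. \<Sum>j\<in>S - {i}. (w i j * (a i + b j)) * (a i + b j))"
    unfolding power2_eq_square mult.assoc
    by (intro sum_mono mult_right_mono) (use w in auto)
  also have "\<dots> = (\<Sum>i\<in>S. a i * (\<Sum>j\<in>S - {i}. w i j * (a i + b j)))
      + (\<Sum>j\<in>S. b j * (\<Sum>i\<in>S - {j}. w i j * (a i + b j)))"
    by (rule offdiag_energy[OF S])
  also have "\<dots> \<le> (\<Sum>i\<in>S. \<bar>a i\<bar> * r) + (\<Sum>j\<in>S. \<bar>b j\<bar> * r)"
  proof (intro add_mono sum_mono)
    fix i assume i: "i \<in> S"
    show "a i * (\<Sum>j\<in>S - {i}. w i j * (a i + b j)) \<le> \<bar>a i\<bar> * r"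
      by (rule order_trans[OF abs_ge_self]) (use row[OF i] in \<open>simp add: abs_mult mult_left_mono\<close>)
    show "b i * (\<Sum>j\<in>S - {i}. w j i * (a j + b i)) \<le> \<bar>b i\<bar> * r"
      by (rule order_trans[OF abs_ge_self]) (use col[OF i] in \<open>simp add: abs_mult mult_left_mono\<close>)
  qed
  also have "\<dots> = r * T"
    by (simp add: T_def sum.distrib sum_distrib_left algebra_simps)
  finally have energy: "m * ((n - 2) * Q) \<le> r * T" .
  have "T\<^sup>2 \<le> (\<Sum>i\<in>S. (\<bar>a i\<bar> + \<bar>b i\<bar>)\<^sup>2) * n"
    unfolding T_def n_def by (rule sum_squared_le_sum_of_squares)
  also have "(\<Sum>i\<in>S. (\<bar>a i\<bar> + \<bar>b i\<bar>)\<^sup>2) \<le> (\<Sum>i\<in>S. 2 * ((a i)\<^sup>2 + (b i)\<^sup>2))"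
  proof (rule sum_mono)
    fix i
    show "(\<bar>a i\<bar> + \<bar>b i\<bar>)\<^sup>2 \<le> 2 * ((a i)\<^sup>2 + (b i)\<^sup>2)"
      using zero_le_power2[of "\<bar>a i\<bar> - \<bar>b i\<bar>"] by (simp add: power2_sum power2_diff)
  qed
  also have "\<dots> = 2 * Q" by (simp add: Q_def sum_distrib_left)
  finally have TQ: "T\<^sup>2 \<le> 2 * n * Q" using n by (simp add: mult_ac)
  have Q0: "Q \<ge> 0" unfolding Q_def by (intro sum_nonneg) auto
  have "m * T\<^sup>2 \<le> m * (2 * n * Q)" using TQ m by simp
  \<comment> \<open>\<open>n / (n - 2) \<le> 3\<close> for \<open>n \<ge> 3\<close>\<close>
  also have "\<dots> \<le> 6 * (m * ((n - 2) * Q))"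
  proof -
    have "2 * n * Q \<le> 6 * ((n - 2) * Q)"
      unfolding mult.assoc[symmetric] using n Q0 by (intro mult_right_mono) auto
    then show ?thesis using mult_left_mono[of "2 * n * Q" "6 * ((n - 2) * Q)" m] m by simp
  qed
  also have "\<dots> \<le> 6 * (r * T)" using energy by simp
  finally have "(m * T) * T \<le> (6 * r) * T" by (simp add: power2_eq_square mult_ac)
  then have "m * T \<le> 6 * r"
    using T0 r by (cases "T = 0") (auto simp: mult_le_cancel_right)
  then show ?thesis using m by (simp add: T_def[symmetric] field_simps)
qed

text \<open>
  The equation of node \<open>i\<close>, solved for its own unknown \<open>c\<close>: the coefficient of \<open>c\<close> is at least
  \<open>m * (card S - 1)\<close>, while the other unknowns contribute at most a quarter of their \<open>\<ell>\<^sup>1\<close> norm.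
  This is where the factor \<open>1 / card S\<close> is gained.
\<close>
lemma node_bound:
  fixes w :: "'a \<Rightarrow> real"
  assumes S: "finite S" and card: "card S \<ge> 3" and m: "m > 0" "m \<le> 1/4" and r: "r \<ge> 0" and i: "i \<in> S"
    and w: "\<And>j. j \<in> S \<Longrightarrow> j \<noteq> i \<Longrightarrow> m \<le> w j \<and> w j \<le> 1/4"
    and row: "\<bar>\<Sum>j\<in>S - {i}. w j * (c + b j)\<bar> \<le> r"
    and b: "(\<Sum>j\<in>S. \<bar>b j\<bar>) \<le> 6 * r / m"
  shows "\<bar>c\<bar> \<le> 3 * r / (m\<^sup>2 * card S)"
proof -
  define n where "n = real (card S)"
  have n: "n \<ge> 3" using card by (simp add: n_def)
  have eq: "c * (\<Sum>j\<in>S - {i}. w j) = (\<Sum>j\<in>S - {i}. w j * (c + b j)) - (\<Sum>j\<in>S - {i}. w j * b j)"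
    by (simp add: algebra_simps sum.distrib sum_distrib_left sum_distrib_right)
  have "\<bar>\<Sum>j\<in>S - {i}. w j * b j\<bar> \<le> (\<Sum>j\<in>S - {i}. \<bar>w j * b j\<bar>)" by (rule sum_abs)
  also have "\<dots> \<le> (\<Sum>j\<in>S - {i}. 1/4 * \<bar>b j\<bar>)"
    unfolding abs_mult by (intro sum_mono mult_right_mono) (use w m in force)+
  also have "\<dots> \<le> 1/4 * (\<Sum>j\<in>S. \<bar>b j\<bar>)"
    unfolding sum_distrib_left by (intro sum_mono2) (use S in auto)
  also have "\<dots> \<le> 3/2 * (r / m)" using b by simp
  finally have A: "\<bar>\<Sum>j\<in>S - {i}. w j * b j\<bar> \<le> 3/2 * (r / m)" .
  have "m * r \<le> 1/4 * r" using m r by (intro mult_right_mono) auto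
  then have B: "r \<le> 1/4 * (r / m)" using m by (simp add: field_simps)
  have "m * (n - 1) = (\<Sum>j\<in>S - {i}. m)" using i S card by (simp add: n_def of_nat_diff)
  also have "\<dots> \<le> (\<Sum>j\<in>S - {i}. w j)" by (intro sum_mono) (use w in auto)
  finally have W: "m * (n - 1) \<le> (\<Sum>j\<in>S - {i}. w j)" .
  have W0: "0 < m * (n - 1)" using m n by simp
  have "m * (2/3 * n) * \<bar>c\<bar> \<le> m * (n - 1) * \<bar>c\<bar>"
    using m n by (intro mult_right_mono mult_left_mono) auto
  also have "\<dots> \<le> (\<Sum>j\<in>S - {i}. w j) * \<bar>c\<bar>" using W by (intro mult_right_mono) auto
  also have "\<dots> = \<bar>c * (\<Sum>j\<in>S - {i}. w j)\<bar>" using W W0 by (simp add: abs_mult)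
  also have "\<dots> \<le> r + 3/2 * (r / m)" unfolding eq using row A by linarith
  also have "\<dots> \<le> 2 * (r / m)" using B divide_nonneg_pos[OF r m(1)] by linarith
  finally have "m * (2/3 * n) * \<bar>c\<bar> \<le> 2 * (r / m)" .
  then have "(m * m * n) * \<bar>c\<bar> \<le> 3 * r" using m by (simp add: field_simps)
  then show ?thesis using m n by (simp add: n_def[symmetric] pos_le_divide_eq power2_eq_square mult_ac)
qed

lemma ex_avoiding_two:
  assumes "card S \<ge> 3"
  obtains x where "x \<in> S" "x \<noteq> u" "x \<noteq> v"
proof -
  have "\<not> S \<subseteq> {u, v}"
  proof
    assume "S \<subseteq> {u, v}"
    then have "card S \<le> card {u, v}" by (intro card_mono) auto
    also have "\<dots> \<le> 2" by (simp add: card_insert_if)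
    finally show False using assms by simp
  qed
  then show ?thesis using that by auto
qed

text \<open>
  The row and column sums determine the unknowns only up to adding \<open>t\<close> to all \<open>a i\<close> and subtracting
  it from all \<open>b j\<close>. The bound is first proved for the balanced representative; the anchor
  \<open>b s = 0\<close> then bounds \<open>t\<close>, at the price of a factor \<open>2\<close>.
\<close>
lemma weighted_system_bound:
  fixes a b :: "'a \<Rightarrow> real" and w :: "'a \<Rightarrow> 'a \<Rightarrow> real"
  assumes S: "finite S" and card: "card S \<ge> 3" and m: "m > 0" and r: "r \<ge> 0"
    and w: "\<And>i j. i \<in> S \<Longrightarrow> j \<in> S \<Longrightarrow> i \<noteq> j \<Longrightarrow> m \<le> w i j \<and> w i j \<le> 1/4"
    and row: "\<And>i. i \<in> S \<Longrightarrow> \<bar>\<Sum>j\<in>S - {i}. w i j * (a i + b j)\<bar> \<le> r"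
    and col: "\<And>j. j \<in> S \<Longrightarrow> \<bar>\<Sum>i\<in>S - {j}. w i j * (a i + b j)\<bar> \<le> r"
    and s: "s \<in> S" "b s = 0" and k: "k \<in> S"
  shows "\<bar>a k\<bar> \<le> 6 * r / (m\<^sup>2 * card S)" and "\<bar>b k\<bar> \<le> 6 * r / (m\<^sup>2 * card S)"
proof -
  define t where "t = (sum b S - sum a S) / (2 * real (card S))"
  define a' where "a' = (\<lambda>i. a i + t)"
  define b' where "b' = (\<lambda>j. b j - t)"
  have ab: "a' i + b' j = a i + b j" for i j by (simp add: a'_def b'_def)
  have bal: "sum a' S = sum b' S"
  proof -
    have "real (card S) * t = (sum b S - sum a S) / 2" using card by (simp add: t_def)
    then have "sum a S + c = sum b S - c" if "c = real (card S) * t" for c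
      using that by (simp add: field_simps)
    then show ?thesis by (simp add: a'_def b'_def sum.distrib sum_subtractf)
  qed
  obtain j where j: "j \<in> S" "j \<noteq> s"
    using ex_avoiding_two[OF card] by blast
  have m4: "m \<le> 1/4" using w[OF j(1) s(1) j(2)] by linarith
  have T: "(\<Sum>i\<in>S. \<bar>a' i\<bar> + \<bar>b' i\<bar>) \<le> 6 * r / m"
    by (rule weighted_balanced_bound[OF S card m r w _ _ bal]) (use row col in \<open>auto simp: ab\<close>)
  have Ta: "(\<Sum>i\<in>S. \<bar>a' i\<bar>) \<le> 6 * r / m" and Tb: "(\<Sum>i\<in>S. \<bar>b' i\<bar>) \<le> 6 * r / m"
    using T sum_abs_ge_zero[of a' S] sum_abs_ge_zero[of b' S] unfolding sum.distrib by linarith+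
  have A: "\<bar>a' i\<bar> \<le> 3 * r / (m\<^sup>2 * card S)" if i: "i \<in> S" for i
    by (rule node_bound[where w = "\<lambda>j. w i j" and b = b' and i = i, OF S card m m4 r i _ _ Tb])
       (use w row i in \<open>auto simp: ab\<close>)
  have B: "\<bar>b' i\<bar> \<le> 3 * r / (m\<^sup>2 * card S)" if i: "i \<in> S" for i
    by (rule node_bound[where w = "\<lambda>j. w j i" and b = a' and i = i, OF S card m m4 r i _ _ Ta])
       (use w col i in \<open>auto simp: ab add.commute[of "b' _"]\<close>)
  have t: "\<bar>t\<bar> \<le> 3 * r / (m\<^sup>2 * card S)" using B[OF s(1)] s(2) by (simp add: b'_def)
  show "\<bar>a k\<bar> \<le> 6 * r / (m\<^sup>2 * card S)" "\<bar>b k\<bar> \<le> 6 * r / (m\<^sup>2 * card S)"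
    using A[OF k] B[OF k] t by (auto simp: a'_def b'_def)
qed

section \<open>Solvability of the moment equations for a strongly increasing link\<close>

lemma antiderivative_exists:
  fixes g :: "real \<Rightarrow> real"
  assumes "\<And>x. isCont g x"
  obtains G where "\<And>x. (G has_real_derivative g x) (at x)"
  using einterval_antiderivative[of "-\<infinity>" \<infinity> g] assms
  by (auto simp: has_real_derivative_iff_has_vector_derivative)

lemma strongly_convex_lower_bound:
  fixes \<phi> h :: "real \<Rightarrow> real"
  assumes deriv: "\<And>x. (\<phi> has_real_derivative h x) (at x)"
    and mono: "\<And>x y. y \<le> x \<Longrightarrow> m * (x - y) \<le> h x - h y"
  shows "\<phi> 0 + h 0 * x + m / 2 * x\<^sup>2 \<le> \<phi> x"
proof -
  define \<psi> where "\<psi> = (\<lambda>x. \<phi> x - h 0 * x - m / 2 * x\<^sup>2)"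
  have d: "(\<psi> has_real_derivative (h z - h 0 - m * z)) (at z)" for z
    unfolding \<psi>_def by (auto intro!: derivative_eq_intros deriv)
  have "\<psi> 0 \<le> \<psi> x"
  proof (cases "0 \<le> x")
    case True
    show ?thesis
    proof (rule DERIV_nonneg_imp_nondecreasing[OF True])
      fix z :: real assume "0 \<le> z"
      then show "\<exists>y. (\<psi> has_real_derivative y) (at z) \<and> 0 \<le> y"
        using d[of z] mono[of 0 z] by (intro exI[of _ "h z - h 0 - m * z"]) auto
    qed
  next
    case False
    then have "x \<le> 0" by simp
    then show ?thesis
    proof (rule DERIV_nonpos_imp_nonincreasing)
      fix z :: real assume "z \<le> 0"
      then show "\<exists>y. (\<psi> has_real_derivative y) (at z) \<and> y \<le> 0"
        using d[of z] mono[of z 0] by (intro exI[of _ "h z - h 0 - m * z"]) auto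
    qed
  qed
  then show ?thesis by (simp add: \<psi>_def)
qed

lemma compact_box:
  fixes c :: "'a \<Rightarrow> real set"
  assumes "\<And>i. compact (c i)"
  shows "compact (PiE UNIV c)"
  using compactin_PiE[of "\<lambda>i::'a. euclidean :: real topology" UNIV c] assms
  by (simp add: euclidean_product_topology)

text \<open>
  Only the summands in row \<open>k\<close> depend on the coordinate \<open>a k\<close>. Applied to the transposed family,
  this also gives the partial derivatives in the second argument.
\<close>
lemma offdiag_sum_partial_derivative:
  fixes \<phi> h :: "'a \<Rightarrow> 'a \<Rightarrow> real \<Rightarrow> real"
  assumes S: "finite S" and k: "k \<in> S"
    and deriv: "\<And>i j x. (\<phi> i j has_real_derivative h i j x) (at x)"
  shows "((\<lambda>t. \<Sum>i\<in>S. \<Sum>j\<in>S - {i}. \<phi> i j ((a(k := t)) i + b j)) has_real_derivative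
           (\<Sum>j\<in>S - {k}. h k j (a k + b j))) (at (a k))"
proof -
  let ?D = "\<lambda>i j. if i = k then h k j (a k + b j) else 0"
  have summand: "((\<lambda>t. \<phi> i j ((a(k := t)) i + b j)) has_real_derivative ?D i j) (at (a k))" for i j
  proof (cases "i = k")
    case True
    have "((\<lambda>t. \<phi> k j (t + b j)) has_real_derivative h k j (a k + b j) * (1 + 0)) (at (a k))"
      by (intro DERIV_chain'[where f = "\<lambda>t. t + b j"] DERIV_add DERIV_ident DERIV_const deriv)
    then show ?thesis using True by simp
  qed simp
  have "((\<lambda>t. \<Sum>i\<in>S. \<Sum>j\<in>S - {i}. \<phi> i j ((a(k := t)) i + b j)) has_real_derivative
      (\<Sum>i\<in>S. \<Sum>j\<in>S - {i}. ?D i j)) (at (a k))"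
    by (intro DERIV_sum summand)
  also have "(\<Sum>i\<in>S. \<Sum>j\<in>S - {i}. ?D i j) = (\<Sum>i\<in>S. if i = k then \<Sum>j\<in>S - {k}. h k j (a k + b j) else 0)"
    by (intro sum.cong) auto
  also have "\<dots> = (\<Sum>j\<in>S - {k}. h k j (a k + b j))" using S k by simp
  finally show ?thesis .
qed

text \<open>
  Strong convexity of each summand bounds every sum \<open>a i + b j\<close> with \<open>i \<noteq> j\<close> on the sublevel set of
  the origin. The individual coordinates are reached from the anchor \<open>b s = 0\<close>: first \<open>a i\<close> for
  \<open>i \<noteq> s\<close>, then \<open>b j\<close> through a third node, which exists because \<open>card S \<ge> 3\<close>, and finally \<open>a s\<close>.
\<close>
lemma sublevel_bounded:
  fixes \<phi> h :: "'a \<Rightarrow> 'a \<Rightarrow> real \<Rightarrow> real"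
  assumes S: "finite S" and card: "card S \<ge> 3" and s: "s \<in> S" and m: "m > 0"
    and deriv: "\<And>i j x. (\<phi> i j has_real_derivative h i j x) (at x)"
    and mono: "\<And>i j x y. y \<le> x \<Longrightarrow> m * (x - y) \<le> h i j x - h i j y"
  obtains R where "R > 0"
    and "\<And>a b k. b s = 0 \<Longrightarrow> k \<in> S \<Longrightarrow>
      (\<Sum>i\<in>S. \<Sum>j\<in>S - {i}. \<phi> i j (a i + b j)) \<le> (\<Sum>i\<in>S. \<Sum>j\<in>S - {i}. \<phi> i j 0) \<Longrightarrow>
      \<bar>a k\<bar> < R \<and> \<bar>b k\<bar> < R"
proof -
  define P where "P = (\<Sum>i\<in>S. \<Sum>j\<in>S - {i}. (h i j 0)\<^sup>2 / m)"
  define X where "X = 4 * P / m + 1"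
  have P0: "P \<ge> 0" unfolding P_def by (intro sum_nonneg) (use m in auto)
  then have X1: "X \<ge> 1" using m by (simp add: X_def)
  have goal: "\<bar>a k\<bar> < 4 * X \<and> \<bar>b k\<bar> < 4 * X"
    if bs: "b s = 0" and k: "k \<in> S"
      and le: "(\<Sum>i\<in>S. \<Sum>j\<in>S - {i}. \<phi> i j (a i + b j)) \<le> (\<Sum>i\<in>S. \<Sum>j\<in>S - {i}. \<phi> i j 0)"
    for a b k
  proof -
    have summand: "m / 4 * x\<^sup>2 - (h i j 0)\<^sup>2 / m \<le> \<phi> i j x - \<phi> i j 0" for i j x
    proof -
      \<comment> \<open>completing the square absorbs the linear term of the lower bound into half of the quadratic one\<close>
      have "0 \<le> (m * x / 2 + h i j 0)\<^sup>2 / m" using m by simp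
      also have "\<dots> = m / 4 * x\<^sup>2 + h i j 0 * x + (h i j 0)\<^sup>2 / m"
        using m by (simp add: field_simps power2_eq_square)
      finally show ?thesis
        using strongly_convex_lower_bound[OF deriv mono, of i j x] by simp
    qed
    have "m / 4 * (\<Sum>i\<in>S. \<Sum>j\<in>S - {i}. (a i + b j)\<^sup>2) - P
        = (\<Sum>i\<in>S. \<Sum>j\<in>S - {i}. m / 4 * (a i + b j)\<^sup>2 - (h i j 0)\<^sup>2 / m)"
      by (simp add: P_def sum_subtractf sum_distrib_left)
    also have "\<dots> \<le> (\<Sum>i\<in>S. \<Sum>j\<in>S - {i}. \<phi> i j (a i + b j) - \<phi> i j 0)"
      by (intro sum_mono summand)
    also have "\<dots> \<le> 0" using le by (simp add: sum_subtractf)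
    finally have total: "(\<Sum>i\<in>S. \<Sum>j\<in>S - {i}. (a i + b j)\<^sup>2) \<le> 4 * P / m"
      using m by (simp add: field_simps)
    have edge: "\<bar>a i + b j\<bar> \<le> X" if ij: "i \<in> S" "j \<in> S" "i \<noteq> j" for i j
    proof -
      have "(a i + b j)\<^sup>2 \<le> (\<Sum>j\<in>S - {i}. (a i + b j)\<^sup>2)"
        by (rule member_le_sum[of j "S - {i}" "\<lambda>j. (a i + b j)\<^sup>2"]) (use S ij in auto)
      also have "\<dots> \<le> (\<Sum>i\<in>S. \<Sum>j\<in>S - {i}. (a i + b j)\<^sup>2)"
        by (rule member_le_sum[of i S "\<lambda>i. \<Sum>j\<in>S - {i}. (a i + b j)\<^sup>2"])
           (use S ij in \<open>auto intro: sum_nonneg\<close>)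
      also have "\<dots> \<le> X" using total by (simp add: X_def)
      also have "X \<le> X\<^sup>2" using X1 by (simp add: power2_eq_square)
      finally have "\<bar>a i + b j\<bar>\<^sup>2 \<le> X\<^sup>2" by simp
      then show ?thesis using X1 power2_le_imp_le[of "\<bar>a i + b j\<bar>" X] by simp
    qed
    have a_off: "\<bar>a i\<bar> \<le> X" if "i \<in> S" "i \<noteq> s" for i
      using edge[OF that(1) s that(2)] bs by simp
    have b_bd: "\<bar>b j\<bar> \<le> 2 * X" if j: "j \<in> S" for j
    proof (cases "j = s")
      case False
      obtain i where "i \<in> S" "i \<noteq> j" "i \<noteq> s" using ex_avoiding_two[OF card] by blast
      then show ?thesis using edge[of i j] a_off[of i] j by force
    qed (use bs X1 in auto)
    obtain j where j: "j \<in> S" "j \<noteq> s"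
      using ex_avoiding_two[OF card] by blast
    have "\<bar>a s\<bar> \<le> 3 * X" using edge[OF s j(1) j(2)[symmetric]] b_bd[OF j(1)] by linarith
    then have "\<bar>a k\<bar> \<le> 3 * X" using a_off[OF k] X1 by (cases "k = s") auto
    then show ?thesis using b_bd[OF k] X1 by linarith
  qed
  show ?thesis by (rule that[of "4 * X"]) (use X1 goal in auto)
qed

text \<open>
  With \<open>G' = g\<close>, the equations say that the partial derivatives of the convex function
  \<open>F a b = (\<Sum>i\<in>S. \<Sum>j\<in>S - {i}. G (a i + b j) - y i j * (a i + b j))\<close> vanish. Its minimum over a
  compact box larger than the sublevel set of the origin is attained in the interior, so these
  derivatives do vanish there, except possibly the one in the fixed coordinate \<open>b s\<close>; that
  equation is the difference of the sum of all row equations and the other column equations.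
\<close>
lemma moment_equations_solvable:
  fixes g :: "real \<Rightarrow> real" and y :: "'a \<Rightarrow> 'a \<Rightarrow> real"
  assumes S: "finite S" and card: "card S \<ge> 3" and s: "s \<in> S" and m: "m > 0"
    and cont: "\<And>x. isCont g x"
    and mono: "\<And>x y. y \<le> x \<Longrightarrow> m * (x - y) \<le> g x - g y"
  obtains a b where "b s = 0"
    and "\<And>i. i \<in> S \<Longrightarrow> (\<Sum>j\<in>S - {i}. g (a i + b j)) = (\<Sum>j\<in>S - {i}. y i j)"
    and "\<And>j. j \<in> S \<Longrightarrow> (\<Sum>i\<in>S - {j}. g (a i + b j)) = (\<Sum>i\<in>S - {j}. y i j)"
proof -
  obtain G where G: "\<And>x. (G has_real_derivative g x) (at x)"
    using antiderivative_exists[OF cont] by blast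
  define \<phi> where "\<phi> = (\<lambda>i j x. G x - y i j * x)"
  define h where "h = (\<lambda>i j x. g x - y i j)"
  have deriv: "(\<phi> i j has_real_derivative h i j x) (at x)" for i j x
    unfolding \<phi>_def h_def by (auto intro!: derivative_eq_intros G)
  have h_mono: "m * (x - z) \<le> h i j x - h i j z" if "z \<le> x" for i j x z
    using mono[OF that] by (simp add: h_def)
  define F where "F = (\<lambda>a b. \<Sum>i\<in>S. \<Sum>j\<in>S - {i}. \<phi> i j (a i + b j))"
  obtain R where R: "R > 0" and bounded: "\<And>a b k. b s = 0 \<Longrightarrow> k \<in> S \<Longrightarrow>
      F a b \<le> F (\<lambda>_. 0) (\<lambda>_. 0) \<Longrightarrow> \<bar>a k\<bar> < R \<and> \<bar>b k\<bar> < R"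
    by (rule sublevel_bounded[where \<phi> = \<phi> and h = h, OF S card s m deriv h_mono]) (auto simp: F_def)
  define K :: "('a \<Rightarrow> real) set" where "K = PiE UNIV (\<lambda>_. {-R..R})"
  define K' :: "('a \<Rightarrow> real) set" where "K' = PiE UNIV (\<lambda>j. if j = s then {0} else {-R..R})"
  have compact: "compact (K \<times> K')"
    unfolding K_def K'_def by (intro compact_Times compact_box) auto
  have zero: "((\<lambda>_. 0), (\<lambda>_. 0)) \<in> K \<times> K'" using R by (auto simp: K_def K'_def)
  have \<phi>_cont: "continuous_on UNIV (\<phi> i j)" for i j
    using deriv by (meson DERIV_isCont continuous_at_imp_continuous_on)
  have coord_a: "continuous_on UNIV (\<lambda>p :: ('a \<Rightarrow> real) \<times> ('a \<Rightarrow> real). fst p i)" for i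
    by (rule continuous_on_product_then_coordinatewise) (intro continuous_intros)
  have coord_b: "continuous_on UNIV (\<lambda>p :: ('a \<Rightarrow> real) \<times> ('a \<Rightarrow> real). snd p i)" for i
    by (rule continuous_on_product_then_coordinatewise) (intro continuous_intros)
  have "continuous_on UNIV (\<lambda>p. F (fst p) (snd p))"
    unfolding F_def
    by (intro continuous_on_sum continuous_on_compose2[OF \<phi>_cont] continuous_on_add coord_a coord_b) auto
  then have "continuous_on (K \<times> K') (\<lambda>p. F (fst p) (snd p))"
    by (rule continuous_on_subset) auto
  then obtain p where p: "p \<in> K \<times> K'" and min: "\<And>q. q \<in> K \<times> K' \<Longrightarrow> F (fst p) (snd p) \<le> F (fst q) (snd q)"
    using continuous_attains_inf[OF compact, of "\<lambda>p. F (fst p) (snd p)"] zero by blast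
  define a where "a = fst p"
  define b where "b = snd p"
  have a: "a \<in> K" and b: "b \<in> K'" using p by (auto simp: a_def b_def mem_Times_iff)
  have min: "F a b \<le> F a' b'" if "a' \<in> K" "b' \<in> K'" for a' b'
    using min[of "(a', b')"] that by (simp add: a_def b_def)
  have bs: "b s = 0" using b by (auto simp: K'_def PiE_def Pi_def split: if_splits)
  have "F a b \<le> F (\<lambda>_. 0) (\<lambda>_. 0)" using min zero by auto
  then have interior: "\<bar>a k\<bar> < R" "\<bar>b k\<bar> < R" if "k \<in> S" for k
    using bounded[of b k a] bs that by auto
  have row: "(\<Sum>j\<in>S - {i}. h i j (a i + b j)) = 0" if i: "i \<in> S" for i
  proof (rule DERIV_local_min)
    show "((\<lambda>t. F (a(i := t)) b) has_real_derivative (\<Sum>j\<in>S - {i}. h i j (a i + b j))) (at (a i))"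
      unfolding F_def by (rule offdiag_sum_partial_derivative[OF S i deriv])
    show "0 < R - \<bar>a i\<bar>" using interior[OF i] by simp
    show "\<forall>t. \<bar>a i - t\<bar> < R - \<bar>a i\<bar> \<longrightarrow> F (a(i := a i)) b \<le> F (a(i := t)) b"
    proof (intro allI impI)
      fix t assume "\<bar>a i - t\<bar> < R - \<bar>a i\<bar>"
      then have "\<bar>t\<bar> \<le> R" by linarith
      then have "a(i := t) \<in> K" using a by (auto simp: K_def PiE_def Pi_def)
      then show "F (a(i := a i)) b \<le> F (a(i := t)) b" using min b by simp
    qed
  qed
  have col_off: "(\<Sum>i\<in>S - {j}. h i j (a i + b j)) = 0" if j: "j \<in> S" "j \<noteq> s" for j
  proof (rule DERIV_local_min)
    have "((\<lambda>t. \<Sum>j'\<in>S. \<Sum>i\<in>S - {j'}. \<phi> i j' ((b(j := t)) j' + a i)) has_real_derivative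
        (\<Sum>i\<in>S - {j}. h i j (b j + a i))) (at (b j))"
      by (rule offdiag_sum_partial_derivative[where \<phi> = "\<lambda>j i. \<phi> i j" and h = "\<lambda>j i. h i j", OF S j(1) deriv])
    moreover have "F a (b(j := t)) = (\<Sum>j'\<in>S. \<Sum>i\<in>S - {j'}. \<phi> i j' ((b(j := t)) j' + a i))" for t
      unfolding F_def by (subst sum_offdiag_swap[OF S]) (simp add: add.commute)
    ultimately show "((\<lambda>t. F a (b(j := t))) has_real_derivative (\<Sum>i\<in>S - {j}. h i j (a i + b j))) (at (b j))"
      by (simp add: add.commute)
    show "0 < R - \<bar>b j\<bar>" using interior[OF j(1)] by simp
    show "\<forall>t. \<bar>b j - t\<bar> < R - \<bar>b j\<bar> \<longrightarrow> F a (b(j := b j)) \<le> F a (b(j := t))"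
    proof (intro allI impI)
      fix t assume "\<bar>b j - t\<bar> < R - \<bar>b j\<bar>"
      then have "\<bar>t\<bar> \<le> R" by linarith
      then have "b(j := t) \<in> K'" using b j by (auto simp: K'_def PiE_iff split: if_splits)
      then show "F a (b(j := b j)) \<le> F a (b(j := t))" using min a by simp
    qed
  qed
  have col: "(\<Sum>i\<in>S - {j}. h i j (a i + b j)) = 0" if j: "j \<in> S" for j
  proof (cases "j = s")
    case True
    have "0 = (\<Sum>i\<in>S. \<Sum>j\<in>S - {i}. h i j (a i + b j))" using row by simp
    also have "\<dots> = (\<Sum>j\<in>S. \<Sum>i\<in>S - {j}. h i j (a i + b j))" by (rule sum_offdiag_swap[OF S])
    also have "\<dots> = (\<Sum>i\<in>S - {s}. h i s (a i + b s))"
      using col_off by (subst sum.remove[OF S s]) simp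
    finally show ?thesis using True by simp
  qed (use col_off j in auto)
  show ?thesis
    by (rule that[of b a]) (use bs row col in \<open>auto simp: h_def sum_subtractf\<close>)
qed

section \<open>The logistic function and its continuation with positive slope\<close>

definition logistic :: "real \<Rightarrow> real" where
  "logistic x = exp x / (1 + exp x)"

lemma logistic_pos: "0 < logistic x" and logistic_less_1: "logistic x < 1"
  by (simp_all add: logistic_def add_pos_pos)

lemma logistic_has_derivative:
  "(logistic has_real_derivative (logistic x * (1 - logistic x))) (at x)"
proof -
  have nz: "1 + exp x \<noteq> 0" using exp_gt_zero[of x] by linarith
  have "((\<lambda>x. exp x / (1 + exp x)) has_real_derivative
      (exp x * (1 + exp x) - exp x * exp x) / ((1 + exp x) * (1 + exp x))) (at x)"
    by (rule derivative_eq_intros refl nz)+ (simp add: nz)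
  moreover have "(exp x * (1 + exp x) - exp x * exp x) / ((1 + exp x) * (1 + exp x))
      = logistic x * (1 - logistic x)"
    using nz by (simp add: logistic_def field_simps)
  moreover have "logistic = (\<lambda>x. exp x / (1 + exp x))" by (simp add: logistic_def fun_eq_iff)
  ultimately show ?thesis by metis
qed

text \<open>
  The derivative of \<open>logistic\<close> is \<open>exp x / (1 + exp x)\<^sup>2\<close>, which is at least \<open>exp (- \<bar>x\<bar>) / 4\<close> since
  \<open>1 + exp x\<close> is at most twice the larger of \<open>1\<close> and \<open>exp x\<close>.
\<close>
lemma logistic_variance_bounds:
  assumes "\<bar>x\<bar> \<le> L"
  shows "exp (-L) / 4 \<le> logistic x * (1 - logistic x)" and "logistic x * (1 - logistic x) \<le> 1 / 4"
proof -
  show "logistic x * (1 - logistic x) \<le> 1 / 4"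
    using zero_le_power2[of "logistic x - 1 / 2"] by (simp add: power2_eq_square algebra_simps)
  have pos: "1 + exp x > 0" by (simp add: add_pos_pos)
  have var: "logistic x * (1 - logistic x) = exp x / (1 + exp x)\<^sup>2"
    using pos by (simp add: logistic_def field_simps power2_eq_square)
  have "exp (-\<bar>x\<bar>) * (1 + exp x)\<^sup>2 \<le> 4 * exp x"
  proof (cases "x \<ge> 0")
    case True
    have "(1 + exp x)\<^sup>2 \<le> (2 * exp x)\<^sup>2" using True by (intro power_mono) auto
    then have "exp (-x) * (1 + exp x)\<^sup>2 \<le> exp (-x) * (2 * exp x)\<^sup>2" by (intro mult_left_mono) auto
    also have "\<dots> = 4 * exp x" by (simp add: power2_eq_square exp_minus field_simps)
    finally show ?thesis using True by simp
  next
    case False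
    have "(1 + exp x)\<^sup>2 \<le> 2\<^sup>2" using False by (intro power_mono) (auto simp: add_nonneg_nonneg)
    then show ?thesis using False mult_left_mono[of "(1 + exp x)\<^sup>2" 4 "exp x"] by simp
  qed
  then have "exp (-\<bar>x\<bar>) / 4 \<le> exp x / (1 + exp x)\<^sup>2" using pos by (simp add: field_simps)
  moreover have "exp (-L) \<le> exp (-\<bar>x\<bar>)" using assms by simp
  ultimately show "exp (-L) / 4 \<le> logistic x * (1 - logistic x)" unfolding var by linarith
qed

lemma logistic_increment:
  assumes "y \<le> x" "-L \<le> y" "x \<le> L"
  shows "exp (-L) / 4 * (x - y) \<le> logistic x - logistic y" and "logistic x - logistic y \<le> 1 / 4 * (x - y)"
proof -
  have "exp (-L) / 4 * (x - y) \<le> logistic x - logistic y \<and> logistic x - logistic y \<le> 1 / 4 * (x - y)"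
  proof (cases "x = y")
    case False
    then have "y < x" using assms by simp
    then obtain z where z: "y < z" "z < x" and
        eq: "logistic x - logistic y = (x - y) * (logistic z * (1 - logistic z))"
      using MVT2[OF \<open>y < x\<close> logistic_has_derivative] by blast
    have "\<bar>z\<bar> \<le> L" using z assms by linarith
    from logistic_variance_bounds[OF this] show ?thesis
      unfolding eq using \<open>y < x\<close>
      unfolding mult.commute[of "x - y"] by (intro conjI mult_right_mono) auto
  qed simp
  then show "exp (-L) / 4 * (x - y) \<le> logistic x - logistic y"
    and "logistic x - logistic y \<le> 1 / 4 * (x - y)" by auto
qed

definition clamp_real :: "real \<Rightarrow> real \<Rightarrow> real" where
  "clamp_real L x = max (- L) (min L x)"

text \<open>
  The slope \<open>exp (- L) / 4\<close> of the linear pieces is the lower bound for the derivative of \<open>logistic\<close> on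
  \<open>{- L..L}\<close>. Thus the modified function has difference quotients between this number and \<open>1 / 4\<close> on
  the whole line.
\<close>
definition tame_logistic :: "real \<Rightarrow> real \<Rightarrow> real" where
  "tame_logistic L x = logistic (clamp_real L x) + exp (- L) / 4 * (x - clamp_real L x)"

lemma tame_logistic_eq: "\<bar>x\<bar> \<le> L \<Longrightarrow> tame_logistic L x = logistic x"
  by (simp add: tame_logistic_def clamp_real_def)

lemma tame_logistic_increment:
  assumes L: "L \<ge> 0" and le: "y \<le> x"
  shows "exp (-L) / 4 * (x - y) \<le> tame_logistic L x - tame_logistic L y"
    and "tame_logistic L x - tame_logistic L y \<le> 1 / 4 * (x - y)"
proof -
  let ?m = "exp (-L) / 4" and ?cx = "clamp_real L x" and ?cy = "clamp_real L y"
  have c: "?cy \<le> ?cx" "- L \<le> ?cy" "?cx \<le> L" and d: "?cx - ?cy \<le> x - y"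
    using L le by (auto simp: clamp_real_def)
  note inc = logistic_increment[OF c]
  have eq: "tame_logistic L x - tame_logistic L y
      = (logistic ?cx - logistic ?cy) + ?m * ((x - y) - (?cx - ?cy))"
    unfolding tame_logistic_def by (simp only: right_diff_distrib)
  have scale: "k * (x - y) = k * (?cx - ?cy) + k * ((x - y) - (?cx - ?cy))" for k
    by (simp add: algebra_simps)
  show "?m * (x - y) \<le> tame_logistic L x - tame_logistic L y"
    unfolding eq scale[of ?m] using inc(1) by simp
  have "?m * ((x - y) - (?cx - ?cy)) \<le> 1 / 4 * ((x - y) - (?cx - ?cy))"
    using d L by (intro mult_right_mono) auto
  then show "tame_logistic L x - tame_logistic L y \<le> 1 / 4 * (x - y)"
    unfolding eq scale[of "1 / 4"] using inc(2) by linarith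
qed

lemma tame_logistic_continuous: "isCont (tame_logistic L) x"
proof -
  have "continuous_on UNIV logistic"
    using logistic_has_derivative by (meson DERIV_isCont continuous_at_imp_continuous_on)
  moreover have clamp: "continuous_on UNIV (clamp_real L)"
    unfolding clamp_real_def by (intro continuous_intros)
  ultimately have "continuous_on UNIV (\<lambda>x. logistic (clamp_real L x))"
    by (rule continuous_on_compose2) auto
  then have "continuous_on UNIV (\<lambda>x. tame_logistic L x)"
    unfolding tame_logistic_def
    by (rule continuous_on_add) (intro continuous_on_mult continuous_on_diff continuous_on_const continuous_on_id clamp)
  then show ?thesis by (simp add: continuous_on_eq_continuous_at)
qed

text \<open>
  The difference quotient as a function of both arguments, with a value in the admissible range on
  the diagonal; it serves as the weight that linearizes differences of moment equations without error.
\<close>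
lemma tame_logistic_slope:
  assumes L: "L \<ge> 0"
  obtains w where "\<And>x y. exp (-L) / 4 \<le> w x y" and "\<And>x y. w x y \<le> 1 / 4"
    and "\<And>x y. w x y * (x - y) = tame_logistic L x - tame_logistic L y"
proof -
  define w where "w = (\<lambda>x y. if x = y then 1 / 4 else (tame_logistic L x - tame_logistic L y) / (x - y))"
  have *: "exp (-L) / 4 \<le> w x y \<and> w x y \<le> 1 / 4" if "y \<le> x" for x y
    using tame_logistic_increment[OF L that] that L
    by (auto simp: w_def pos_le_divide_eq pos_divide_le_eq)
  have sym: "w x y = w y x" for x y
    unfolding w_def by (simp add: minus_divide_left[symmetric] divide_simps) (simp add: algebra_simps)
  have bounds: "exp (-L) / 4 \<le> w x y \<and> w x y \<le> 1 / 4" for x y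
    using *[of x y] *[of y x] sym[of x y] by (cases "y \<le> x") auto
  have "w x y * (x - y) = tame_logistic L x - tame_logistic L y" for x y
    by (simp add: w_def)
  then show ?thesis using that[of w] bounds by auto
qed

section \<open>Stability, existence and uniqueness for logistic moment equations\<close>

lemma tame_moment_stability:
  fixes a b a' b' :: "'a \<Rightarrow> real"
  assumes S: "finite S" and card: "card S \<ge> 3" and s: "s \<in> S" "b s = b' s" and L: "L \<ge> 0" and r: "r \<ge> 0"
    and row: "\<And>i. i \<in> S \<Longrightarrow> \<bar>\<Sum>j\<in>S - {i}. tame_logistic L (a i + b j) - tame_logistic L (a' i + b' j)\<bar> \<le> r"
    and col: "\<And>j. j \<in> S \<Longrightarrow> \<bar>\<Sum>i\<in>S - {j}. tame_logistic L (a i + b j) - tame_logistic L (a' i + b' j)\<bar> \<le> r"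
    and k: "k \<in> S"
  shows "\<bar>a k - a' k\<bar> \<le> 6 * r / ((exp (-L) / 4)\<^sup>2 * card S)"
    and "\<bar>b k - b' k\<bar> \<le> 6 * r / ((exp (-L) / 4)\<^sup>2 * card S)"
proof -
  obtain w where w: "\<And>x y. exp (-L) / 4 \<le> w x y" "\<And>x y. w x y \<le> 1 / 4"
      and slope: "\<And>x y. w x y * (x - y) = tame_logistic L x - tame_logistic L y"
    using tame_logistic_slope[OF L] by metis
  let ?W = "\<lambda>i j. w (a i + b j) (a' i + b' j)"
  have eq: "?W i j * ((a i - a' i) + (b j - b' j))
      = tame_logistic L (a i + b j) - tame_logistic L (a' i + b' j)" for i j
    using slope[of "a i + b j" "a' i + b' j"] by (simp add: algebra_simps)
  note bound = weighted_system_bound[where w = ?W and a = "\<lambda>i. a i - a' i" and b = "\<lambda>j. b j - b' j"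
      and m = "exp (-L) / 4" and r = r and s = s, OF S card _ r _ _ _ s(1) _ k]
  show "\<bar>a k - a' k\<bar> \<le> 6 * r / ((exp (-L) / 4)\<^sup>2 * card S)"
    by (rule bound(1)) (use w row col s in \<open>simp_all add: eq\<close>)
  show "\<bar>b k - b' k\<bar> \<le> 6 * r / ((exp (-L) / 4)\<^sup>2 * card S)"
    by (rule bound(2)) (use w row col s in \<open>simp_all add: eq\<close>)
qed

text \<open>
  The solution of the modified equations is within \<open>\<rho> \<le> 1\<close> of \<open>\<alpha>, \<beta>\<close> by stability, so each argument
  \<open>a i + b j\<close> is at most \<open>2 * (B + 1)\<close> in absolute value. This is the reason for \<open>L = 2 * B + 2\<close>.
\<close>
lemma logistic_moment_solution_near:
  fixes \<alpha> \<beta> :: "'a \<Rightarrow> real" and y :: "'a \<Rightarrow> 'a \<Rightarrow> real"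
  assumes S: "finite S" and card: "card S \<ge> 3" and s: "s \<in> S" "\<beta> s = 0" and r: "r \<ge> 0"
    and bound: "\<And>i. i \<in> S \<Longrightarrow> \<bar>\<alpha> i\<bar> \<le> B \<and> \<bar>\<beta> i\<bar> \<le> B"
    and row: "\<And>i. i \<in> S \<Longrightarrow> \<bar>\<Sum>j\<in>S - {i}. y i j - logistic (\<alpha> i + \<beta> j)\<bar> \<le> r"
    and col: "\<And>j. j \<in> S \<Longrightarrow> \<bar>\<Sum>i\<in>S - {j}. y i j - logistic (\<alpha> i + \<beta> j)\<bar> \<le> r"
    and \<rho>: "\<rho> = 6 * r / ((exp (- (2 * B + 2)) / 4)\<^sup>2 * card S)" "\<rho> \<le> 1"
  obtains a b where "b s = 0"
    and "\<And>i. i \<in> S \<Longrightarrow> \<bar>a i - \<alpha> i\<bar> \<le> \<rho> \<and> \<bar>b i - \<beta> i\<bar> \<le> \<rho>"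
    and "\<And>i. i \<in> S \<Longrightarrow> (\<Sum>j\<in>S - {i}. logistic (a i + b j)) = (\<Sum>j\<in>S - {i}. y i j)"
    and "\<And>j. j \<in> S \<Longrightarrow> (\<Sum>i\<in>S - {j}. logistic (a i + b j)) = (\<Sum>i\<in>S - {j}. y i j)"
proof -
  define L where "L = 2 * B + 2"
  have B0: "B \<ge> 0" using bound[OF s(1)] by linarith
  then have L: "L \<ge> 0" by (simp add: L_def)
  obtain a b where bs: "b s = 0"
    and rows: "\<And>i. i \<in> S \<Longrightarrow> (\<Sum>j\<in>S - {i}. tame_logistic L (a i + b j)) = (\<Sum>j\<in>S - {i}. y i j)"
    and cols: "\<And>j. j \<in> S \<Longrightarrow> (\<Sum>i\<in>S - {j}. tame_logistic L (a i + b j)) = (\<Sum>i\<in>S - {j}. y i j)"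
    by (rule moment_equations_solvable[OF S card s(1) _ tame_logistic_continuous
          tame_logistic_increment(1)[OF L], of y]) auto
  have true_arg: "tame_logistic L (\<alpha> i + \<beta> j) = logistic (\<alpha> i + \<beta> j)" if "i \<in> S" "j \<in> S" for i j
    by (rule tame_logistic_eq) (use bound[OF that(1)] bound[OF that(2)] in \<open>auto simp: L_def\<close>)
  have R: "\<bar>\<Sum>j\<in>S - {i}. tame_logistic L (a i + b j) - tame_logistic L (\<alpha> i + \<beta> j)\<bar> \<le> r" if i: "i \<in> S" for i
    using row[OF i] i by (simp add: sum_subtractf rows true_arg)
  have C: "\<bar>\<Sum>i\<in>S - {j}. tame_logistic L (a i + b j) - tame_logistic L (\<alpha> i + \<beta> j)\<bar> \<le> r" if j: "j \<in> S" for j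
    using col[OF j] j by (simp add: sum_subtractf cols true_arg)
  have close: "\<bar>a k - \<alpha> k\<bar> \<le> \<rho> \<and> \<bar>b k - \<beta> k\<bar> \<le> \<rho>" if "k \<in> S" for k
    using tame_moment_stability[OF S card s(1) _ L r R C that] bs s(2) by (simp add: \<rho> L_def)
  have "tame_logistic L (a i + b j) = logistic (a i + b j)" if "i \<in> S" "j \<in> S" for i j
  proof (rule tame_logistic_eq)
    show "\<bar>a i + b j\<bar> \<le> L"
      using close[OF that(1)] close[OF that(2)] bound[OF that(1)] bound[OF that(2)] \<rho>(2)
      unfolding L_def by linarith
  qed
  then show ?thesis
    using that[of b a] bs close rows cols by simp
qed

text \<open>
  Any two given solutions have their arguments in a common interval \<open>{- L..L}\<close>, where \<open>logistic\<close>
  agrees with its modification; stability then applies with \<open>r = 0\<close>.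
\<close>
lemma logistic_moment_solution_unique:
  fixes a b a' b' :: "'a \<Rightarrow> real"
  assumes S: "finite S" and card: "card S \<ge> 3" and s: "s \<in> S" "b s = b' s"
    and row: "\<And>i. i \<in> S \<Longrightarrow> (\<Sum>j\<in>S - {i}. logistic (a i + b j)) = (\<Sum>j\<in>S - {i}. logistic (a' i + b' j))"
    and col: "\<And>j. j \<in> S \<Longrightarrow> (\<Sum>i\<in>S - {j}. logistic (a i + b j)) = (\<Sum>i\<in>S - {j}. logistic (a' i + b' j))"
    and k: "k \<in> S"
  shows "a k = a' k" and "b k = b' k"
proof -
  define M where "M = (\<Sum>i\<in>S. \<bar>a i\<bar> + \<bar>b i\<bar> + \<bar>a' i\<bar> + \<bar>b' i\<bar>)"
  define L where "L = 2 * M"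
  have M: "\<bar>a i\<bar> + \<bar>b i\<bar> + \<bar>a' i\<bar> + \<bar>b' i\<bar> \<le> M" if "i \<in> S" for i
    unfolding M_def
    by (rule member_le_sum[of i S "\<lambda>i. \<bar>a i\<bar> + \<bar>b i\<bar> + \<bar>a' i\<bar> + \<bar>b' i\<bar>"]) (use S that in auto)
  have L: "L \<ge> 0" using M[OF k] unfolding L_def by linarith
  have "\<bar>a i\<bar> \<le> M" "\<bar>b i\<bar> \<le> M" "\<bar>a' i\<bar> \<le> M" "\<bar>b' i\<bar> \<le> M" if "i \<in> S" for i
    using M[OF that] abs_ge_zero[of "a i"] abs_ge_zero[of "b i"] abs_ge_zero[of "a' i"] abs_ge_zero[of "b' i"]
    by - (rule order_trans[rotated], assumption, simp)+
  moreover have "tame_logistic L (u + v) = logistic (u + v)" if "\<bar>u\<bar> \<le> M" "\<bar>v\<bar> \<le> M" for u v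
    by (rule tame_logistic_eq) (use that in \<open>unfold L_def, linarith\<close>)
  ultimately have eq: "tame_logistic L (a i + b j) = logistic (a i + b j)"
      "tame_logistic L (a' i + b' j) = logistic (a' i + b' j)" if "i \<in> S" "j \<in> S" for i j
    using that by auto
  have "\<bar>a k - a' k\<bar> \<le> 6 * 0 / ((exp (-L) / 4)\<^sup>2 * card S)"
       "\<bar>b k - b' k\<bar> \<le> 6 * 0 / ((exp (-L) / 4)\<^sup>2 * card S)"
    by (rule tame_moment_stability[where a = a and b = b and a' = a' and b' = b',
          OF S card s L _ _ _ k]; simp add: eq row col sum_subtractf)+
  then show "a k = a' k" and "b k = b' k" by auto
qed

section \<open>The estimating equations\<close>

lemma keep_prob_bounds:
  assumes "\<epsilon> > 0"
  shows "1 / 2 < keep_prob \<epsilon>" and "keep_prob \<epsilon> < 1"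
  using assms by (simp_all add: keep_prob_def field_simps add_pos_pos)

lemma flipped_mean_logistic:
  "flipped_mean n \<epsilon> \<theta> i j =
     (1 - keep_prob \<epsilon>) + (2 * keep_prob \<epsilon> - 1) * logistic (alpha \<theta> i + beta n \<theta> j)"
proof -
  have "1 + exp (alpha \<theta> i + beta n \<theta> j) \<noteq> 0" by (metis add_pos_pos exp_gt_zero less_irrefl zero_less_one)
  then show ?thesis by (simp add: flipped_mean_def logistic_def field_simps)
qed

lemma flipped_mean_between:
  assumes "\<epsilon> > 0"
  shows "0 < flipped_mean n \<epsilon> \<theta> i j" and "flipped_mean n \<epsilon> \<theta> i j < 1"
proof -
  let ?p = "keep_prob \<epsilon>" and ?l = "logistic (alpha \<theta> i + beta n \<theta> j)"
  have "0 < (2 * ?p - 1) * ?l" "0 < (2 * ?p - 1) * (1 - ?l)"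
    using keep_prob_bounds[OF assms] logistic_pos logistic_less_1 by auto
  then show "0 < flipped_mean n \<epsilon> \<theta> i j" and "flipped_mean n \<epsilon> \<theta> i j < 1"
    using keep_prob_bounds[OF assms] by (simp_all add: flipped_mean_logistic algebra_simps)
qed

text \<open>
  The affine image of an entry of the flipped graph whose mean is the edge probability of the
  unflipped model.
\<close>
definition debiased :: "real \<Rightarrow> digraph \<Rightarrow> nat \<Rightarrow> nat \<Rightarrow> real" where
  "debiased \<epsilon> G i j = (of_bool (G (i, j)) - (1 - keep_prob \<epsilon>)) / (2 * keep_prob \<epsilon> - 1)"

lemma debiased_diff:
  assumes "\<epsilon> > 0"
  shows "debiased \<epsilon> G i j - logistic (alpha \<theta> i + beta n \<theta> j) =
    (of_bool (G (i, j)) - flipped_mean n \<epsilon> \<theta> i j) / (2 * keep_prob \<epsilon> - 1)"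
  using keep_prob_bounds[OF assms]
  by (simp add: debiased_def flipped_mean_logistic field_simps)

lemma degree_equation_iff:
  assumes "\<epsilon> > 0"
  shows "(\<Sum>x\<in>X. of_bool (G (f x, h x))) = (\<Sum>x\<in>X. flipped_mean n \<epsilon> \<theta> (f x) (h x)) \<longleftrightarrow>
     (\<Sum>x\<in>X. logistic (alpha \<theta> (f x) + beta n \<theta> (h x))) = (\<Sum>x\<in>X. debiased \<epsilon> G (f x) (h x))"
proof -
  have "(\<Sum>x\<in>X. debiased \<epsilon> G (f x) (h x)) - (\<Sum>x\<in>X. logistic (alpha \<theta> (f x) + beta n \<theta> (h x)))
     = ((\<Sum>x\<in>X. of_bool (G (f x, h x))) - (\<Sum>x\<in>X. flipped_mean n \<epsilon> \<theta> (f x) (h x))) / (2 * keep_prob \<epsilon> - 1)"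
    unfolding sum_subtractf[symmetric] sum_divide_distrib
    by (intro sum.cong refl debiased_diff assms)
  moreover have "2 * keep_prob \<epsilon> - 1 \<noteq> 0" using keep_prob_bounds[OF assms] by simp
  ultimately show ?thesis
    by (metis (no_types, lifting) divide_eq_0_iff right_minus_eq)
qed

lemma is_estimate_iff:
  assumes "\<epsilon> > 0"
  shows "is_estimate n \<epsilon> G \<eta> \<longleftrightarrow> \<eta> \<in> rvec (2 * n - 1) \<and>
    (\<forall>i\<in>{1..n}. (\<Sum>j\<in>{1..n} - {i}. logistic (alpha \<eta> i + beta n \<eta> j)) = (\<Sum>j\<in>{1..n} - {i}. debiased \<epsilon> G i j)) \<and>
    (\<forall>j\<in>{1..n - 1}. (\<Sum>i\<in>{1..n} - {j}. logistic (alpha \<eta> i + beta n \<eta> j)) = (\<Sum>i\<in>{1..n} - {j}. debiased \<epsilon> G i j))"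
proof -
  note rowE = degree_equation_iff[OF assms, of G "\<lambda>_. i" "\<lambda>j. j" _ n \<eta> for i]
  note colE = degree_equation_iff[OF assms, of G "\<lambda>i. i" "\<lambda>_. j" _ n \<eta> for j]
  show ?thesis
    unfolding is_estimate_def out_degree_def in_degree_def of_nat_sum of_nat_of_bool rowE colE ..
qed

text \<open>
  The definition of an estimate omits the in-degree of node \<open>n\<close>, but stability treats all nodes alike.
  The omitted equation follows since rows and columns have the same total.
\<close>
lemma is_estimate_all_columns:
  assumes \<epsilon>: "\<epsilon> > 0" and est: "is_estimate n \<epsilon> G \<eta>" and j: "j \<in> {1..n}"
  shows "(\<Sum>i\<in>{1..n} - {j}. logistic (alpha \<eta> i + beta n \<eta> j)) = (\<Sum>i\<in>{1..n} - {j}. debiased \<epsilon> G i j)"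
proof (cases "j = n")
  case False
  then show ?thesis using est j unfolding is_estimate_iff[OF \<epsilon>] by auto
next
  case True
  define D where "D = (\<lambda>i j. logistic (alpha \<eta> i + beta n \<eta> j) - debiased \<epsilon> G i j)"
  have row: "(\<Sum>j\<in>{1..n} - {i}. D i j) = 0" if "i \<in> {1..n}" for i
    using est that unfolding is_estimate_iff[OF \<epsilon>] D_def sum_subtractf by auto
  have col: "(\<Sum>i\<in>{1..n} - {j}. D i j) = 0" if "j \<in> {1..n} - {n}" for j
    using est that unfolding is_estimate_iff[OF \<epsilon>] D_def sum_subtractf by auto
  have "0 = (\<Sum>i\<in>{1..n}. \<Sum>j\<in>{1..n} - {i}. D i j)" using row by simp
  also have "\<dots> = (\<Sum>j\<in>{1..n}. \<Sum>i\<in>{1..n} - {j}. D i j)" by (rule sum_offdiag_swap) simp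
  also have "\<dots> = (\<Sum>i\<in>{1..n} - {n}. D i n) + (\<Sum>j\<in>{1..n} - {n}. \<Sum>i\<in>{1..n} - {j}. D i j)"
    using j True by (intro sum.remove) auto
  also have "(\<Sum>j\<in>{1..n} - {n}. \<Sum>i\<in>{1..n} - {j}. D i j) = 0" using col by (intro sum.neutral) auto
  finally show ?thesis using True by (simp add: D_def sum_subtractf)
qed

lemma rvec_eqI:
  assumes \<eta>: "\<eta> \<in> rvec (2 * n - 1)" "\<eta>' \<in> rvec (2 * n - 1)"
    and eq: "\<And>k. k \<in> {1..n} \<Longrightarrow> alpha \<eta> k = alpha \<eta>' k" "\<And>k. k \<in> {1..n} \<Longrightarrow> beta n \<eta> k = beta n \<eta>' k"
  shows "\<eta> = \<eta>'"
proof (rule PiE_ext[OF \<eta>[unfolded rvec_def]])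
  fix k assume k: "k \<in> {1..2 * n - 1}"
  show "\<eta> k = \<eta>' k"
  proof (cases "k \<le> n")
    case True
    then show ?thesis using eq(1)[of k] k by (simp add: alpha_def)
  next
    case False
    then obtain j where "k = n + j" "j \<in> {1..n}" "j \<noteq> n"
      using k by (intro that[of "k - n"]) auto
    then show ?thesis using eq(2)[of j] by (simp add: beta_def)
  qed
qed

text \<open>
  With two nodes, \<open>\<alpha>\<^sub>2\<close> and \<open>\<beta>\<^sub>1\<close> enter the equations only through their sum, so uniqueness can hold
  only vacuously. It does: an out-degree is \<open>0\<close> or \<open>1\<close>, while the flipped mean it has to equal is
  strictly between.
\<close>
lemma no_estimate_two_nodes:
  assumes "\<epsilon> > 0"
  shows "\<not> is_estimate 2 \<epsilon> G \<eta>"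
proof
  assume "is_estimate 2 \<epsilon> G \<eta>"
  then have "real (out_degree 2 G 1) = (\<Sum>j\<in>{1..2} - {1}. flipped_mean 2 \<epsilon> \<eta> 1 j)"
    unfolding is_estimate_def by force
  moreover have "{1..2} - {1} = {2::nat}" by auto
  ultimately have "of_bool (G (1, 2)) = flipped_mean 2 \<epsilon> \<eta> 1 2" by (simp add: out_degree_def del: sum_of_bool_eq)
  then show False using flipped_mean_between[OF assms, of 2 \<eta> 1 2] by (cases "G (1, 2)") auto
qed

lemma estimate_unique:
  assumes n: "n \<ge> 2" and \<epsilon>: "\<epsilon> > 0" and est: "is_estimate n \<epsilon> G \<eta>" "is_estimate n \<epsilon> G \<eta>'"
  shows "\<eta> = \<eta>'"
proof (cases "n = 2")
  case True
  then show ?thesis using no_estimate_two_nodes[OF \<epsilon>] est by blast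
next
  case False
  then have card: "card {1..n} \<ge> 3" using n by simp
  have row: "(\<Sum>j\<in>{1..n} - {i}. logistic (alpha \<eta> i + beta n \<eta> j))
      = (\<Sum>j\<in>{1..n} - {i}. logistic (alpha \<eta>' i + beta n \<eta>' j))" if "i \<in> {1..n}" for i
    using est that unfolding is_estimate_iff[OF \<epsilon>] by auto
  have col: "(\<Sum>i\<in>{1..n} - {j}. logistic (alpha \<eta> i + beta n \<eta> j))
      = (\<Sum>i\<in>{1..n} - {j}. logistic (alpha \<eta>' i + beta n \<eta>' j))" if "j \<in> {1..n}" for j
    using est[THEN is_estimate_all_columns[OF \<epsilon> _ that]] by simp
  have s: "n \<in> {1..n}" "beta n \<eta> n = beta n \<eta>' n" using n by (auto simp: beta_def)
  show ?thesis
  proof (rule rvec_eqI)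
    show "\<eta> \<in> rvec (2 * n - 1)" "\<eta>' \<in> rvec (2 * n - 1)" using est by (auto simp: is_estimate_def)
    fix k assume k: "k \<in> {1..n}"
    show "alpha \<eta> k = alpha \<eta>' k" "beta n \<eta> k = beta n \<eta>' k"
      using logistic_moment_solution_unique[of "{1..n}" n "beta n \<eta>" "beta n \<eta>'" "alpha \<eta>" "alpha \<eta>'" k]
        card s row col k by auto
  qed
qed

text \<open>
  Existence and accuracy for a fixed graph, given that all its degrees are within \<open>d\<close> of their means.
  Debiasing divides the deviations by \<open>2 * keep_prob \<epsilon> - 1\<close>. The deviation of the last
  in-degree has to be controlled too: it is determined by the others, but as a sum of \<open>2 * n - 1\<close> of
  them it could be \<open>2 * n - 1\<close> times as large, and would then shift all coordinates together.
\<close>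
lemma estimate_near_truth:
  assumes n: "n \<ge> 3" and \<epsilon>: "\<epsilon> > 0" and d: "d \<ge> 0"
    and bound: "\<And>k. k \<in> {1..2 * n - 1} \<Longrightarrow> \<bar>\<theta> k\<bar> \<le> B"
    and row: "\<And>i. i \<in> {1..n} \<Longrightarrow> \<bar>\<Sum>j\<in>{1..n} - {i}. of_bool (G (i, j)) - flipped_mean n \<epsilon> \<theta> i j\<bar> \<le> d"
    and col: "\<And>j. j \<in> {1..n} \<Longrightarrow> \<bar>\<Sum>i\<in>{1..n} - {j}. of_bool (G (i, j)) - flipped_mean n \<epsilon> \<theta> i j\<bar> \<le> d"
    and \<rho>: "\<rho> = 6 * (d / (2 * keep_prob \<epsilon> - 1)) / ((exp (- (2 * B + 2)) / 4)\<^sup>2 * n)" "\<rho> \<le> 1"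
  obtains \<eta> where "is_estimate n \<epsilon> G \<eta>" and "\<And>k. k \<in> {1..2 * n - 1} \<Longrightarrow> \<bar>\<eta> k - \<theta> k\<bar> \<le> \<rho>"
proof -
  let ?\<tau> = "2 * keep_prob \<epsilon> - 1"
  have \<tau>: "?\<tau> > 0" using keep_prob_bounds[OF \<epsilon>] by simp
  have card: "card {1..n} \<ge> 3" and s: "n \<in> {1..n}" "beta n \<theta> n = 0" using n by (auto simp: beta_def)
  have r: "d / ?\<tau> \<ge> 0" using d \<tau> by simp
  have B0: "B \<ge> 0" using bound[of 1] n by force
  have bd: "\<bar>alpha \<theta> i\<bar> \<le> B \<and> \<bar>beta n \<theta> i\<bar> \<le> B" if "i \<in> {1..n}" for i
    using that bound[of i] bound[of "n + i"] B0 n by (auto simp: alpha_def beta_def)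
  have R: "\<bar>\<Sum>j\<in>{1..n} - {i}. debiased \<epsilon> G i j - logistic (alpha \<theta> i + beta n \<theta> j)\<bar> \<le> d / ?\<tau>"
    if "i \<in> {1..n}" for i
    using row[OF that] \<tau> by (simp add: debiased_diff[OF \<epsilon>] flip: sum_divide_distrib) (simp add: divide_right_mono)
  have C: "\<bar>\<Sum>i\<in>{1..n} - {j}. debiased \<epsilon> G i j - logistic (alpha \<theta> i + beta n \<theta> j)\<bar> \<le> d / ?\<tau>"
    if "j \<in> {1..n}" for j
    using col[OF that] \<tau> by (simp add: debiased_diff[OF \<epsilon>] flip: sum_divide_distrib) (simp add: divide_right_mono)
  obtain a b where bn: "b n = 0"
    and close: "\<And>i. i \<in> {1..n} \<Longrightarrow> \<bar>a i - alpha \<theta> i\<bar> \<le> \<rho> \<and> \<bar>b i - beta n \<theta> i\<bar> \<le> \<rho>"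
    and rows: "\<And>i. i \<in> {1..n} \<Longrightarrow> (\<Sum>j\<in>{1..n} - {i}. logistic (a i + b j)) = (\<Sum>j\<in>{1..n} - {i}. debiased \<epsilon> G i j)"
    and cols: "\<And>j. j \<in> {1..n} \<Longrightarrow> (\<Sum>i\<in>{1..n} - {j}. logistic (a i + b j)) = (\<Sum>i\<in>{1..n} - {j}. debiased \<epsilon> G i j)"
    by (rule logistic_moment_solution_near[of "{1..n}" n "beta n \<theta>" "d / ?\<tau>" "alpha \<theta>" B "debiased \<epsilon> G" \<rho>,
          OF _ card s r bd R C _ \<rho>(2)]) (use \<rho>(1) in auto)
  define \<eta> where "\<eta> = (\<lambda>k. if k \<in> {1..2 * n - 1} then if k \<le> n then a k else b (k - n) else undefined)"
  have al: "alpha \<eta> i = a i" and be: "beta n \<eta> i = b i" if "i \<in> {1..n}" for i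
    using that bn n by (auto simp: \<eta>_def alpha_def beta_def)
  have "is_estimate n \<epsilon> G \<eta>"
    unfolding is_estimate_iff[OF \<epsilon>]
  proof (intro conjI ballI)
    show "\<eta> \<in> rvec (2 * n - 1)" by (auto simp: \<eta>_def rvec_def PiE_def extensional_def)
  next
    fix i assume "i \<in> {1..n}"
    then show "(\<Sum>j\<in>{1..n} - {i}. logistic (alpha \<eta> i + beta n \<eta> j)) = (\<Sum>j\<in>{1..n} - {i}. debiased \<epsilon> G i j)"
      using rows[of i] by (simp add: al be)
  next
    fix j assume "j \<in> {1..n - 1}"
    then have "j \<in> {1..n}" by auto
    then show "(\<Sum>i\<in>{1..n} - {j}. logistic (alpha \<eta> i + beta n \<eta> j)) = (\<Sum>i\<in>{1..n} - {j}. debiased \<epsilon> G i j)"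
      using cols[of j] by (simp add: al be)
  qed
  moreover have "\<bar>\<eta> k - \<theta> k\<bar> \<le> \<rho>" if k: "k \<in> {1..2 * n - 1}" for k
  proof (cases "k \<le> n")
    case True
    then show ?thesis using close[of k] k by (simp add: \<eta>_def alpha_def)
  next
    case False
    then obtain j where "k = n + j" "j \<in> {1..n}" "j \<noteq> n"
      using k by (intro that[of "k - n"]) auto
    then show ?thesis using close[of j] k by (simp add: \<eta>_def beta_def)
  qed
  ultimately show ?thesis using that by blast
qed

section \<open>Concentration of the flipped degrees\<close>

lemma finite_ordered_pairs: "finite (ordered_pairs n)"
  by (rule finite_subset[of _ "{1..n} \<times> {1..n}"]) (auto simp: ordered_pairs_def)

lemma flip_bernoulli:
  assumes "0 \<le> q" "q \<le> 1" "0 \<le> p" "p \<le> 1"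
  shows "bernoulli_pmf q \<bind> (\<lambda>a. map_pmf (\<lambda>k. if k then a else \<not> a) (bernoulli_pmf p)) =
    bernoulli_pmf (p * q + (1 - p) * (1 - q))"
proof (rule pmf_eqI)
  fix x :: bool
  have "0 \<le> p * q + (1 - p) * (1 - q)" "p * q + (1 - p) * (1 - q) \<le> 1"
  proof -
    show "0 \<le> p * q + (1 - p) * (1 - q)" using assms by (intro add_nonneg_nonneg mult_nonneg_nonneg) auto
    have "0 \<le> p * (1 - q) + (1 - p) * q" using assms by (intro add_nonneg_nonneg mult_nonneg_nonneg) auto
    then show "p * q + (1 - p) * (1 - q) \<le> 1" by (simp add: algebra_simps)
  qed
  then show "pmf (bernoulli_pmf q \<bind> (\<lambda>a. map_pmf (\<lambda>k. if k then a else \<not> a) (bernoulli_pmf p))) x =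
      pmf (bernoulli_pmf (p * q + (1 - p) * (1 - q))) x"
    using assms by (cases x) (simp_all add: map_pmf_def pmf_bind algebra_simps)
qed

text \<open>
  Drawing the whole graph and then all flips is the same as drawing and flipping each entry
  separately, because \<open>Pi_pmf\<close> commutes with the monadic bind. Off \<open>ordered_pairs n\<close> the defaults
  \<open>False\<close> of the graph and \<open>True\<close> of the keep indicators combine to \<open>False\<close>.
\<close>
lemma flipped_model_eq_product:
  assumes \<epsilon>: "\<epsilon> > 0"
  shows "flipped_model n \<epsilon> \<theta> =
    Pi_pmf (ordered_pairs n) False (\<lambda>(i, j). bernoulli_pmf (flipped_mean n \<epsilon> \<theta> i j))"
proof -
  let ?E = "ordered_pairs n" and ?p = "keep_prob \<epsilon>"
  let ?flip = "\<lambda>a k. if k then a else \<not> a"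
  define q where "q = (\<lambda>(i, j). logistic (alpha \<theta> i + beta n \<theta> j))"
  have q: "0 \<le> q e" "q e \<le> 1" for e
    using logistic_pos logistic_less_1 by (auto simp: q_def less_imp_le split: prod.splits)
  have p: "0 \<le> ?p" "?p \<le> 1" using keep_prob_bounds[OF \<epsilon>] by auto
  have entry: "(\<lambda>(i, j). bernoulli_pmf (flipped_mean n \<epsilon> \<theta> i j)) =
      (\<lambda>e. bernoulli_pmf (q e) \<bind> (\<lambda>a. map_pmf (?flip a) (bernoulli_pmf ?p)))"
  proof
    fix e :: "nat \<times> nat"
    obtain i j where e: "e = (i, j)" by (cases e)
    have "flipped_mean n \<epsilon> \<theta> i j = ?p * q e + (1 - ?p) * (1 - q e)"
      by (simp add: e q_def flipped_mean_logistic algebra_simps)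
    then show "(case e of (i, j) \<Rightarrow> bernoulli_pmf (flipped_mean n \<epsilon> \<theta> i j)) =
        bernoulli_pmf (q e) \<bind> (\<lambda>a. map_pmf (?flip a) (bernoulli_pmf ?p))"
      unfolding flip_bernoulli[OF q p] by (simp add: e)
  qed
  have p0: "p0_model n \<theta> = Pi_pmf ?E False (\<lambda>e. bernoulli_pmf (q e))"
    unfolding p0_model_def q_def logistic_def by (intro arg_cong[where f = "Pi_pmf ?E False"]) auto
  have "flipped_model n \<epsilon> \<theta> =
      p0_model n \<theta> \<bind> (\<lambda>A. map_pmf (\<lambda>K e. ?flip (A e) (K e)) (keep_indicators n \<epsilon>))"
    by (simp add: flipped_model_def pair_pmf_def map_pmf_def bind_assoc_pmf bind_return_pmf)
  also have "\<dots> = p0_model n \<theta> \<bind> (\<lambda>A. Pi_pmf ?E False (\<lambda>e. map_pmf (?flip (A e)) (bernoulli_pmf ?p)))"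
  proof (rule bind_pmf_cong[OF refl])
    fix A assume "A \<in> set_pmf (p0_model n \<theta>)"
    then have A: "\<not> A e" if "e \<notin> ?E" for e
      using set_Pi_pmf_subset[OF finite_ordered_pairs] that by (fastforce simp: p0)
    have "Pi_pmf ?E False (\<lambda>e. map_pmf (?flip (A e)) (bernoulli_pmf ?p)) =
        keep_indicators n \<epsilon> \<bind> (\<lambda>K. return_pmf (\<lambda>e. if e \<in> ?E then ?flip (A e) (K e) else False))"
      unfolding map_pmf_def keep_indicators_def
      by (subst Pi_pmf_bind[OF finite_ordered_pairs, where d' = True])
         (simp only: Pi_pmf_return_pmf[OF finite_ordered_pairs])
    also have "\<dots> = keep_indicators n \<epsilon> \<bind> (\<lambda>K. return_pmf (\<lambda>e. ?flip (A e) (K e)))"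
    proof (rule bind_pmf_cong[OF refl])
      fix K assume "K \<in> set_pmf (keep_indicators n \<epsilon>)"
      then have "K e" if "e \<notin> ?E" for e
        using set_Pi_pmf_subset[OF finite_ordered_pairs] that by (fastforce simp: keep_indicators_def)
      then show "return_pmf (\<lambda>e. if e \<in> ?E then ?flip (A e) (K e) else False) =
          return_pmf (\<lambda>e. ?flip (A e) (K e))"
        using A by (auto simp: fun_eq_iff)
    qed
    finally show "map_pmf (\<lambda>K e. ?flip (A e) (K e)) (keep_indicators n \<epsilon>) =
        Pi_pmf ?E False (\<lambda>e. map_pmf (?flip (A e)) (bernoulli_pmf ?p))"
      by (simp add: map_pmf_def)
  qed
  also have "\<dots> = Pi_pmf ?E False (\<lambda>e. bernoulli_pmf (q e) \<bind> (\<lambda>a. map_pmf (?flip a) (bernoulli_pmf ?p)))"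
    unfolding p0 by (rule Pi_pmf_bind[OF finite_ordered_pairs, symmetric])
  finally show ?thesis unfolding entry .
qed

lemma bernoulli_sum_concentration:
  fixes q :: "'a \<Rightarrow> real"
  assumes E: "finite E" and I: "I \<subseteq> E" "I \<noteq> {}" and t: "t \<ge> 0" and q: "\<And>e. e \<in> E \<Longrightarrow> 0 \<le> q e \<and> q e \<le> 1"
  shows "measure_pmf.prob (Pi_pmf E dflt (\<lambda>e. bernoulli_pmf (q e)))
      {f. t \<le> \<bar>\<Sum>e\<in>I. of_bool (f e) - q e\<bar>} \<le> 2 * exp (- 2 * t\<^sup>2 / card I)"
proof -
  let ?P = "Pi_pmf E dflt (\<lambda>e. bernoulli_pmf (q e))"
  have fin: "finite I" using E I finite_subset by blast
  have mean: "measure_pmf.expectation ?P (\<lambda>f. of_bool (f e)) = q e" if "e \<in> I" for e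
  proof -
    have "measure_pmf.expectation ?P (\<lambda>f. of_bool (f e) :: real) =
        measure_pmf.expectation (map_pmf (\<lambda>f. f e) ?P) of_bool" by simp
    also have "map_pmf (\<lambda>f. f e) ?P = bernoulli_pmf (q e)"
      using that I E by (subst Pi_pmf_component) auto
    finally show ?thesis using q[of e] that I by auto
  qed
  have "prob_space.indep_vars (measure_pmf ?P) (\<lambda>_. count_space UNIV) (\<lambda>e f. f e) I"
    using prob_space.indep_vars_subset[OF measure_pmf.prob_space_axioms indep_vars_Pi_pmf[OF E] I(1)] .
  then have indep: "prob_space.indep_vars (measure_pmf ?P) (\<lambda>_. borel) (\<lambda>e f. of_bool (f e) :: real) I"
    by (rule prob_space.indep_vars_compose2[OF measure_pmf.prob_space_axioms]) auto
  interpret Hoeffding_ineq "measure_pmf ?P" I "\<lambda>e f. of_bool (f e)" "\<lambda>_. 0" "\<lambda>_. 1" "\<Sum>e\<in>I. q e"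
    by unfold_locales (use fin indep mean in auto)
  have "(\<Sum>e\<in>I. (1 - 0)\<^sup>2) > (0 :: real)" using I fin by (simp add: card_gt_0_iff)
  from Hoeffding_ineq_abs_ge[OF t this] show ?thesis by (simp add: sum_subtractf)
qed

text \<open>
  Each degree is a sum of \<open>n - 1\<close> independent indicators, and at the deviation \<open>sqrt (n * ln n)\<close>
  Hoeffding's inequality gives at most \<open>2 * exp (- 2 * ln n) = 2 / n\<^sup>2\<close>. There are \<open>2 * n\<close> degrees.
\<close>
lemma degree_concentration:
  assumes n: "n \<ge> 2" and \<epsilon>: "\<epsilon> > 0"
  defines "t \<equiv> sqrt (n * ln n)"
  shows "measure_pmf.prob (flipped_model n \<epsilon> \<theta>)
      {G. \<exists>k\<in>{1..n}. t \<le> \<bar>\<Sum>j\<in>{1..n} - {k}. of_bool (G (k, j)) - flipped_mean n \<epsilon> \<theta> k j\<bar> \<or>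
                      t \<le> \<bar>\<Sum>i\<in>{1..n} - {k}. of_bool (G (i, k)) - flipped_mean n \<epsilon> \<theta> i k\<bar>} \<le> 4 / n"
proof -
  let ?P = "flipped_model n \<epsilon> \<theta>"
  define q where "q = (\<lambda>(i, j). flipped_mean n \<epsilon> \<theta> i j)"
  define row where "row = (\<lambda>k. {G. t \<le> \<bar>\<Sum>j\<in>{1..n} - {k}. of_bool (G (k, j)) - flipped_mean n \<epsilon> \<theta> k j\<bar>})"
  define col where "col = (\<lambda>k. {G. t \<le> \<bar>\<Sum>i\<in>{1..n} - {k}. of_bool (G (i, k)) - flipped_mean n \<epsilon> \<theta> i k\<bar>})"
  have P: "?P = Pi_pmf (ordered_pairs n) False (\<lambda>e. bernoulli_pmf (q e))"
    unfolding flipped_model_eq_product[OF \<epsilon>] by (intro arg_cong[where f = "Pi_pmf _ False"]) (auto simp: q_def)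
  have q: "0 \<le> q e \<and> q e \<le> 1" for e
    using flipped_mean_between[OF \<epsilon>] by (auto simp: q_def less_imp_le split: prod.splits)
  have t0: "t \<ge> 0" using n by (simp add: t_def)
  have tail: "2 * exp (- 2 * t\<^sup>2 / (n - 1 :: nat)) \<le> 2 / (real n)\<^sup>2"
  proof -
    have ln0: "ln (real n) > 0" using n by simp
    have "2 * ln (real n) * real (n - 1) \<le> 2 * ln (real n) * real n" using ln0 by (intro mult_left_mono) auto
    then have "2 * ln (real n) \<le> 2 * t\<^sup>2 / (n - 1 :: nat)"
      using n ln0 by (simp add: t_def pos_le_divide_eq mult_ac)
    then have "exp (- 2 * t\<^sup>2 / (n - 1 :: nat)) \<le> exp (- (2 * ln (real n)))" by simp
    also have "\<dots> = 1 / (real n)\<^sup>2" using n by (simp add: exp_minus exp_double inverse_eq_divide)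
    finally show ?thesis by simp
  qed
  have row_tail: "measure_pmf.prob ?P (row k) \<le> 2 / (real n)\<^sup>2" if k: "k \<in> {1..n}" for k
  proof -
    let ?I = "Pair k ` ({1..n} - {k})"
    have card: "card ?I = n - 1" using k by (subst card_image) (auto simp: inj_on_def)
    have "?I \<subseteq> ordered_pairs n" using k by (auto simp: ordered_pairs_def)
    moreover have "?I \<noteq> {}"
    proof
      assume "?I = {}"
      then have "card ?I = 0" by (simp only: card.empty)
      then show False using card n by linarith
    qed
    ultimately have "measure_pmf.prob ?P {G. t \<le> \<bar>\<Sum>e\<in>?I. of_bool (G e) - q e\<bar>} \<le> 2 * exp (- 2 * t\<^sup>2 / card ?I)"
      unfolding P by (intro bernoulli_sum_concentration finite_ordered_pairs t0 q)
    also have "{G. t \<le> \<bar>\<Sum>e\<in>?I. of_bool (G e) - q e\<bar>} = row k"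
      unfolding row_def by (subst sum.reindex) (auto simp: inj_on_def q_def)
    finally show ?thesis using tail unfolding card by linarith
  qed
  have col_tail: "measure_pmf.prob ?P (col k) \<le> 2 / (real n)\<^sup>2" if k: "k \<in> {1..n}" for k
  proof -
    let ?I = "(\<lambda>i. (i, k)) ` ({1..n} - {k})"
    have card: "card ?I = n - 1" using k by (subst card_image) (auto simp: inj_on_def)
    have "?I \<subseteq> ordered_pairs n" using k by (auto simp: ordered_pairs_def)
    moreover have "?I \<noteq> {}"
    proof
      assume "?I = {}"
      then have "card ?I = 0" by (simp only: card.empty)
      then show False using card n by linarith
    qed
    ultimately have "measure_pmf.prob ?P {G. t \<le> \<bar>\<Sum>e\<in>?I. of_bool (G e) - q e\<bar>} \<le> 2 * exp (- 2 * t\<^sup>2 / card ?I)"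
      unfolding P by (intro bernoulli_sum_concentration finite_ordered_pairs t0 q)
    also have "{G. t \<le> \<bar>\<Sum>e\<in>?I. of_bool (G e) - q e\<bar>} = col k"
      unfolding col_def by (subst sum.reindex) (auto simp: inj_on_def q_def)
    finally show ?thesis using tail unfolding card by linarith
  qed
  have "measure_pmf.prob ?P (\<Union>k\<in>{1..n}. row k \<union> col k) \<le> (\<Sum>k\<in>{1..n}. measure_pmf.prob ?P (row k \<union> col k))"
    by (rule measure_pmf.finite_measure_subadditive_finite) auto
  also have "\<dots> \<le> (\<Sum>k\<in>{1..n}. 4 / (real n)\<^sup>2)"
  proof (rule sum_mono)
    fix k assume k: "k \<in> {1..n}"
    have "measure_pmf.prob ?P (row k \<union> col k) \<le> measure_pmf.prob ?P (row k) + measure_pmf.prob ?P (col k)"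
      by (rule measure_Un_le) auto
    then show "measure_pmf.prob ?P (row k \<union> col k) \<le> 4 / (real n)\<^sup>2"
      using row_tail[OF k] col_tail[OF k] by linarith
  qed
  also have "\<dots> = 4 / n" using n by (simp add: power2_eq_square)
  finally show ?thesis
    by (rule order_trans[OF eq_refl, rotated]) (auto simp: row_def col_def intro!: arg_cong[where f = "measure_pmf.prob ?P"])
qed

section \<open>Rates\<close>

text \<open>
  \<open>2 * keep_prob \<epsilon> - 1\<close> is \<open>tanh (\<epsilon> / 2) = (exp \<epsilon> - 1) / (1 + exp \<epsilon>)\<close>, and \<open>exp \<epsilon> - 1 \<ge> \<epsilon>\<close>. No positive
  multiple of \<open>\<epsilon>\<close> is a lower bound for all \<open>\<epsilon> > 0\<close>, since this quantity stays below \<open>1\<close>.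
\<close>
lemma keep_prob_gap:
  assumes "\<epsilon> > 0" "\<epsilon> \<le> C"
  shows "\<epsilon> / (1 + exp C) \<le> 2 * keep_prob \<epsilon> - 1"
proof -
  have "2 * keep_prob \<epsilon> - 1 = (exp \<epsilon> - 1) / (1 + exp \<epsilon>)"
  proof -
    have "1 + exp \<epsilon> \<noteq> 0" using exp_gt_zero[of \<epsilon>] by linarith
    then show ?thesis by (simp add: keep_prob_def exp_minus field_simps)
  qed
  moreover have "\<epsilon> / (1 + exp C) \<le> (exp \<epsilon> - 1) / (1 + exp \<epsilon>)"
  proof (intro frac_le)
    show "\<epsilon> \<le> exp \<epsilon> - 1" "0 \<le> exp \<epsilon> - 1" using assms exp_ge_add_one_self[of \<epsilon>] by linarith+
  qed (use assms in \<open>auto simp: add_pos_pos\<close>)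
  ultimately show ?thesis by simp
qed

lemma max_norm_nonneg: "m \<ge> 1 \<Longrightarrow> 0 \<le> max_norm m x"
  unfolding max_norm_def by (rule order_trans[OF abs_ge_zero[of "x 1"]]) (intro Max_ge; force)

lemma abs_le_max_norm: "k \<in> {1..m} \<Longrightarrow> \<bar>x k\<bar> \<le> max_norm m x"
  unfolding max_norm_def by (intro Max_ge) auto

lemma max_norm_le:
  assumes "m \<ge> 1" and "\<And>k. k \<in> {1..m} \<Longrightarrow> \<bar>x k\<bar> \<le> c"
  shows "max_norm m x \<le> c"
  unfolding max_norm_def using assms by (intro Max.boundedI) auto

definition rate :: "nat \<Rightarrow> real \<Rightarrow> (nat \<Rightarrow> real) \<Rightarrow> real" where
  "rate n \<epsilon> \<theta> = ln (real n) powr (1 / 2) * exp (6 * max_norm (2 * n - 1) \<theta>) / (real n powr (1 / 2) * \<epsilon>)"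

text \<open>
  \<open>96 * exp 4\<close> collects the factor \<open>6\<close> of the stability bound and the constants in
  \<open>m\<^sup>-\<^sup>2 = 16 * exp 4 * exp (4 * B)\<close>; the last factor is the one lost in \<open>keep_prob_gap\<close>.
\<close>
definition rate_const :: "real \<Rightarrow> real" where
  "rate_const C = 96 * exp 4 * (1 + exp C)"

lemma rate_const_pos: "rate_const C > 0"
  by (simp add: rate_const_def add_pos_pos)

text \<open>
  For degree deviations \<open>sqrt (n * ln n)\<close> the stability radius is of order
  \<open>exp (4 * B) * sqrt (ln n / n) / \<epsilon>\<close>; passing to the exponent \<open>6 * B\<close> of \<open>rate\<close> only enlarges it.
\<close>
lemma deterministic_radius_le_rate:
  fixes \<theta> :: "nat \<Rightarrow> real"
  assumes n: "n \<ge> 2" and \<epsilon>: "\<epsilon> > 0" "\<epsilon> \<le> C"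
  defines "B \<equiv> max_norm (2 * n - 1) \<theta>"
  shows "6 * (sqrt (n * ln n) / (2 * keep_prob \<epsilon> - 1)) / ((exp (- (2 * B + 2)) / 4)\<^sup>2 * n)
    \<le> rate_const C * rate n \<epsilon> \<theta>"
proof -
  have B: "B \<ge> 0" unfolding B_def using n by (intro max_norm_nonneg) auto
  have C: "1 + exp C > 0" by (simp add: add_pos_pos)
  have "0 < \<epsilon> / (1 + exp C)" using \<epsilon> C by simp
  then have "1 / (2 * keep_prob \<epsilon> - 1) \<le> 1 / (\<epsilon> / (1 + exp C))"
    using keep_prob_gap[OF \<epsilon>] by (intro divide_left_mono mult_pos_pos) auto
  then have gap: "1 / (2 * keep_prob \<epsilon> - 1) \<le> (1 + exp C) / \<epsilon>" by simp
  have sq: "sqrt (n * ln n) / n = sqrt (ln n) / sqrt n"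
    using n real_sqrt_mult_self[of "real n"] by (simp add: real_sqrt_mult field_simps)
  have curv: "1 / (exp (- (2 * B + 2)) / 4)\<^sup>2 = 16 * exp 4 * exp (4 * B)"
    by (simp add: power2_eq_square exp_minus field_simps flip: exp_add)
  have "6 * (sqrt (n * ln n) / (2 * keep_prob \<epsilon> - 1)) / ((exp (- (2 * B + 2)) / 4)\<^sup>2 * n)
      = 6 * (sqrt (n * ln n) / n) * (1 / (exp (- (2 * B + 2)) / 4)\<^sup>2) * (1 / (2 * keep_prob \<epsilon> - 1))"
    by (simp add: mult_ac)
  also have "\<dots> = 96 * exp 4 * (sqrt (ln n) / sqrt n) * exp (4 * B) * (1 / (2 * keep_prob \<epsilon> - 1))"
    unfolding sq curv by simp
  also have "\<dots> \<le> 96 * exp 4 * (sqrt (ln n) / sqrt n) * exp (6 * B) * ((1 + exp C) / \<epsilon>)"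
    using n B gap keep_prob_bounds[OF \<epsilon>(1)] by (intro mult_mono) auto
  also have "\<dots> = rate_const C * rate n \<epsilon> \<theta>"
    using n by (simp add: rate_const_def rate_def B_def powr_half_sqrt)
  finally show ?thesis .
qed

text \<open>
  When no degree deviates by \<open>sqrt (n * ln n)\<close> or more, \<open>estimate_near_truth\<close> applies, so the failure event is
  contained in the event of \<open>degree_concentration\<close>.
\<close>
lemma estimate_within_rate:
  assumes n: "n \<ge> 3" and \<epsilon>: "\<epsilon> > 0" "\<epsilon> \<le> C" and small: "rate_const C * rate n \<epsilon> \<theta> \<le> 1"
  shows "measure_pmf.prob (flipped_model n \<epsilon> \<theta>)
      {G. \<not> (\<exists>\<eta>. is_estimate n \<epsilon> G \<eta> \<and>
            max_norm (2 * n - 1) (\<lambda>k. \<eta> k - \<theta> k) \<le> rate_const C * rate n \<epsilon> \<theta>)} \<le> 4 / n"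
    (is "measure_pmf.prob _ ?bad \<le> _")
proof -
  let ?t = "sqrt (n * ln n)"
  let ?dev = "{G. \<exists>k\<in>{1..n}. ?t \<le> \<bar>\<Sum>j\<in>{1..n} - {k}. of_bool (G (k, j)) - flipped_mean n \<epsilon> \<theta> k j\<bar> \<or>
                      ?t \<le> \<bar>\<Sum>i\<in>{1..n} - {k}. of_bool (G (i, k)) - flipped_mean n \<epsilon> \<theta> i k\<bar>}"
  have n2: "n \<ge> 2" using n by simp
  note radius = deterministic_radius_le_rate[OF n2 \<epsilon>, of \<theta>]
  have "?bad \<subseteq> ?dev"
  proof (rule subsetI, rule ccontr)
    fix G assume bad: "G \<in> ?bad" and "G \<notin> ?dev"
    then have dev: "\<And>k. k \<in> {1..n} \<Longrightarrow>
        \<not> ?t \<le> \<bar>\<Sum>j\<in>{1..n} - {k}. of_bool (G (k, j)) - flipped_mean n \<epsilon> \<theta> k j\<bar> \<and>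
        \<not> ?t \<le> \<bar>\<Sum>i\<in>{1..n} - {k}. of_bool (G (i, k)) - flipped_mean n \<epsilon> \<theta> i k\<bar>" by blast
    have row: "\<bar>\<Sum>j\<in>{1..n} - {k}. of_bool (G (k, j)) - flipped_mean n \<epsilon> \<theta> k j\<bar> \<le> ?t"
      and col: "\<bar>\<Sum>i\<in>{1..n} - {k}. of_bool (G (i, k)) - flipped_mean n \<epsilon> \<theta> i k\<bar> \<le> ?t"
      if "k \<in> {1..n}" for k using dev[OF that] by (meson linear)+
    have t0: "?t \<ge> 0" using n by simp
    obtain \<eta> where est: "is_estimate n \<epsilon> G \<eta>" and close: "\<And>k. k \<in> {1..2 * n - 1} \<Longrightarrow> \<bar>\<eta> k - \<theta> k\<bar>
        \<le> 6 * (?t / (2 * keep_prob \<epsilon> - 1)) / ((exp (- (2 * max_norm (2 * n - 1) \<theta> + 2)) / 4)\<^sup>2 * n)"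
      by (rule estimate_near_truth[OF n \<epsilon>(1) t0 abs_le_max_norm row col refl order_trans[OF radius small]]) auto
    have "max_norm (2 * n - 1) (\<lambda>k. \<eta> k - \<theta> k) \<le> rate_const C * rate n \<epsilon> \<theta>"
      using n close radius by (intro max_norm_le) (auto intro: order_trans)
    then show False using est bad by blast
  qed
  then have "measure_pmf.prob (flipped_model n \<epsilon> \<theta>) ?bad \<le> measure_pmf.prob (flipped_model n \<epsilon> \<theta>) ?dev"
    by (intro measure_pmf.finite_measure_mono) auto
  also have "\<dots> \<le> 4 / n" by (rule degree_concentration[OF n2 \<epsilon>(1)])
  finally show ?thesis .
qed

text \<open>
  The growth condition controls \<open>exp (12 * B) / \<epsilon>\<close>, which dominates \<open>exp (6 * B) / \<epsilon>\<close> as \<open>B \<ge> 0\<close>.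
\<close>
lemma rate_tendsto_zero:
  fixes \<theta> :: "nat \<Rightarrow> nat \<Rightarrow> real" and \<epsilon> :: "nat \<Rightarrow> real"
  assumes \<epsilon>_pos: "\<And>n. n \<ge> 2 \<Longrightarrow> \<epsilon> n > 0"
    and growth: "(\<lambda>n. inverse (\<epsilon> n) * exp (12 * max_norm (2 * n - 1) (\<theta> n)))
                   \<in> o(\<lambda>n. (real n / ln (real n)) powr (1 / 2))"
    and c: "c > 0"
  shows "\<forall>\<^sub>F n in sequentially. rate n (\<epsilon> n) (\<theta> n) \<le> c"
  using landau_o.smallD[OF growth c] eventually_ge_at_top[of 2]
proof eventually_elim
  case (elim n)
  let ?B = "max_norm (2 * n - 1) (\<theta> n)"
  have \<epsilon>: "\<epsilon> n > 0" and ln: "ln (real n) > 0" and n: "real n > 0" using elim \<epsilon>_pos by auto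
  have B: "?B \<ge> 0" using elim by (intro max_norm_nonneg) auto
  have "rate n (\<epsilon> n) (\<theta> n) = (inverse (\<epsilon> n) * exp (6 * ?B)) * (sqrt (ln n) / sqrt n)"
    using n ln by (simp add: rate_def powr_half_sqrt field_simps)
  also have "\<dots> \<le> (inverse (\<epsilon> n) * exp (12 * ?B)) * (sqrt (ln n) / sqrt n)"
    using B \<epsilon> n ln by (intro mult_right_mono mult_left_mono) auto
  also have "\<dots> \<le> (c * (sqrt n / sqrt (ln n))) * (sqrt (ln n) / sqrt n)"
  proof (intro mult_right_mono)
    show "inverse (\<epsilon> n) * exp (12 * ?B) \<le> c * (sqrt n / sqrt (ln n))"
      using elim(1) \<epsilon> n ln by (simp add: powr_half_sqrt real_sqrt_divide)
  qed (use n ln in auto)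
  also have "\<dots> = c" using n ln by simp
  finally show ?case .
qed

theorem theorem1:
  fixes \<theta> :: "nat \<Rightarrow> nat \<Rightarrow> real"
    and \<epsilon> :: "nat \<Rightarrow> real"
    and C :: real
    and \<theta>_hat :: "nat \<Rightarrow> digraph \<Rightarrow> nat \<Rightarrow> real"
  defines "M \<equiv> \<lambda>n. measure_pmf (flipped_model n (\<epsilon> n) (\<theta> n))"
    and "err \<equiv> \<lambda>n G. max_norm (2 * n - 1) (\<lambda>k. \<theta>_hat n G k - \<theta> n k)"
  assumes \<theta>: "\<And>n. n \<ge> 2 \<Longrightarrow> \<theta> n \<in> rvec (2 * n - 1)"
    and \<epsilon>_pos: "\<And>n. n \<ge> 2 \<Longrightarrow> \<epsilon> n > 0"
    and \<epsilon>_le: "\<And>n. n \<ge> 2 \<Longrightarrow> \<epsilon> n \<le> C"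
    and \<theta>_hat: "\<And>n G. n \<ge> 2 \<Longrightarrow> \<exists>\<eta>. is_estimate n (\<epsilon> n) G \<eta> \<Longrightarrow> is_estimate n (\<epsilon> n) G (\<theta>_hat n G)"
    and growth: "(\<lambda>n. inverse (\<epsilon> n) * exp (12 * max_norm (2 * n - 1) (\<theta> n)))
                   \<in> o(\<lambda>n. (real n / ln (real n)) powr (1 / 2))"
  shows "(\<lambda>n. \<P>(G in M n. \<exists>\<eta>. is_estimate n (\<epsilon> n) G \<eta>)) \<longlonglongrightarrow> 1
       \<and> bigo_prob M err (\<lambda>n. ln (real n) powr (1 / 2) * exp (6 * max_norm (2 * n - 1) (\<theta> n))
                               / (real n powr (1 / 2) * \<epsilon> n))
       \<and> smallo_prob M err (\<lambda>_. 1)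
       \<and> (\<forall>n\<ge>2. \<forall>G. (\<exists>\<eta>. is_estimate n (\<epsilon> n) G \<eta>) \<longrightarrow> (\<exists>!\<eta>. is_estimate n (\<epsilon> n) G \<eta>))"
proof -
  let ?K = "rate_const C" and ?r = "\<lambda>n. rate n (\<epsilon> n) (\<theta> n)"
  let ?P = "\<lambda>n. measure_pmf.prob (flipped_model n (\<epsilon> n) (\<theta> n))"
  \<comment> \<open>outside this event an estimate exists and is accurate, so all three limit statements reduce
     to the vanishing of its probability\<close>
  define bad where "bad = (\<lambda>n. {G. \<not> (\<exists>\<eta>. is_estimate n (\<epsilon> n) G \<eta> \<and>
      max_norm (2 * n - 1) (\<lambda>k. \<eta> k - \<theta> n k) \<le> ?K * ?r n)})"
  have K: "?K > 0" by (rule rate_const_pos)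
  have unique: "\<exists>!\<eta>. is_estimate n (\<epsilon> n) G \<eta>" if "n \<ge> 2" "\<exists>\<eta>. is_estimate n (\<epsilon> n) G \<eta>" for n G
    using that estimate_unique[OF that(1) \<epsilon>_pos[OF that(1)]] by blast
  have small: "\<forall>\<^sub>F n in sequentially. ?K * ?r n \<le> c" if "c > 0" for c
    using rate_tendsto_zero[OF \<epsilon>_pos growth, of "c / ?K"] that K by (simp add: field_simps)
  have bad_le: "\<forall>\<^sub>F n in sequentially. ?P n (bad n) \<le> 4 / n"
    using small[of 1, OF zero_less_one] eventually_ge_at_top[of 3]
  proof eventually_elim
    case (elim n)
    then show ?case unfolding bad_def
      by (intro estimate_within_rate) (use \<epsilon>_pos \<epsilon>_le in auto)
  qed
  have lim: "(\<lambda>n. 4 / real n) \<longlonglongrightarrow> 0" by (rule lim_const_over_n)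
  have err_good: "\<bar>err n G\<bar> \<le> ?K * ?r n" if n: "n \<ge> 2" and G: "G \<notin> bad n" for n G
  proof -
    obtain \<eta> where est: "is_estimate n (\<epsilon> n) G \<eta>"
        and close: "max_norm (2 * n - 1) (\<lambda>k. \<eta> k - \<theta> n k) \<le> ?K * ?r n"
      using G by (auto simp: bad_def)
    \<comment> \<open>by uniqueness, the selected estimate is the accurate one\<close>
    have "\<theta>_hat n G = \<eta>" using unique[OF n] est \<theta>_hat[OF n] by blast
    then show ?thesis using close n max_norm_nonneg[of "2 * n - 1" "\<lambda>k. \<eta> k - \<theta> n k"]
      by (simp add: err_def)
  qed
  have mono: "?P n {G. Q G} \<le> ?P n (bad n)" if "\<And>G. G \<notin> bad n \<Longrightarrow> \<not> Q G" for n Q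
    by (rule measure_pmf.finite_measure_mono) (use that in auto)
  have "(\<lambda>n. ?P n {G. \<exists>\<eta>. is_estimate n (\<epsilon> n) G \<eta>}) \<longlonglongrightarrow> 1"
  proof (rule tendsto_sandwich)
    show "\<forall>\<^sub>F n in sequentially. 1 - 4 / real n \<le> ?P n {G. \<exists>\<eta>. is_estimate n (\<epsilon> n) G \<eta>}"
      using bad_le
    proof eventually_elim
      case (elim n)
      have "?P n {G. \<exists>\<eta>. is_estimate n (\<epsilon> n) G \<eta>} = 1 - ?P n {G. \<not> (\<exists>\<eta>. is_estimate n (\<epsilon> n) G \<eta>)}"
        using measure_pmf.prob_neg[of "flipped_model n (\<epsilon> n) (\<theta> n)" "\<lambda>G. \<exists>\<eta>. is_estimate n (\<epsilon> n) G \<eta>"] by simp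
      moreover have "?P n {G. \<not> (\<exists>\<eta>. is_estimate n (\<epsilon> n) G \<eta>)} \<le> ?P n (bad n)"
        by (rule mono) (auto simp: bad_def)
      ultimately show ?case using elim by linarith
    qed
    show "(\<lambda>n. 1 - 4 / real n) \<longlonglongrightarrow> 1" using tendsto_diff[OF tendsto_const lim, of 1] by simp
  qed auto
  moreover have "bigo_prob M err ?r"
    unfolding bigo_prob_def
  proof (intro allI impI exI conjI)
    fix \<delta> :: real assume "\<delta> > 0"
    then have "\<forall>\<^sub>F n in sequentially. 4 / real n < \<delta>" using order_tendstoD(2)[OF lim] by blast
    then show "\<forall>\<^sub>F n in sequentially. \<P>(G in M n. \<bar>err n G\<bar> > ?K * \<bar>?r n\<bar>) < \<delta>"
      using bad_le eventually_ge_at_top[of 2]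
    proof eventually_elim
      case (elim n)
      have "?K * ?r n \<le> ?K * \<bar>?r n\<bar>" using K by (intro mult_left_mono) auto
      then have "?P n {G. \<bar>err n G\<bar> > ?K * \<bar>?r n\<bar>} \<le> ?P n (bad n)"
        by (intro mono) (use err_good[OF elim(3)] in force)
      then show ?case using elim by (simp add: M_def)
    qed
  qed (rule K)
  moreover have "smallo_prob M err (\<lambda>_. 1)"
    unfolding smallo_prob_def
  proof (intro allI impI)
    fix c :: real assume c: "c > 0"
    show "(\<lambda>n. \<P>(G in M n. \<bar>err n G\<bar> > c * \<bar>1\<bar>)) \<longlonglongrightarrow> 0"
    proof (rule tendsto_sandwich[OF _ _ tendsto_const lim])
      show "\<forall>\<^sub>F n in sequentially. \<P>(G in M n. \<bar>err n G\<bar> > c * \<bar>1\<bar>) \<le> 4 / real n"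
        using bad_le small[OF c] eventually_ge_at_top[of 2]
      proof eventually_elim
        case (elim n)
        have "?P n {G. \<bar>err n G\<bar> > c} \<le> ?P n (bad n)"
          by (intro mono) (use err_good[OF elim(3)] elim(2) in force)
        then show ?case using elim by (simp add: M_def)
      qed
    qed auto
  qed
  ultimately show ?thesis using unique by (auto simp: M_def rate_def)
qed

end
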